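(* Let $A\in\mathbb{R}^{n\times n}$ be invertible and let $L=\sum_{j=0}^DA^{D-j}B_j$. The system $x_{t+1}=Ax_t+\sum_{\tau=0}^D (B_\tau+\omega_t^\tau C_\tau)u_{t-\tau}$, $t\ge0$, is asymptotically mean-square stabilizable if and only if there exist a matrix $Y\in\mathbb{R}^{m\times n}$ and a symmetric matrix $S\in\mathbb{R}^{n\times n}$ with $S<0$ satisfying the linear matrix inequality $$\begin{bmatrix}S&*&*&\cdots&*\\ AS+LY&S&*&\cdots&*\\ \sigma_0A^DC_0Y&0&S&\cdots&*\\ \vdots&\vdots&\vdots&\ddots&\vdots\\ \sigma_DA^DC_DY&0&0&\cdots&S\end{bmatrix}<0,$$ where $Y=-KP^{-1}$ and $S=-P^{-1}<0$ (with $P>0$ and $K\in\mathbb{R}^{m\times n}$), and $*$ represents the corresponding transposed block.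
   Context: Primes denote transposes and $\mathbf{E}$ denotes expectation; $M<0$ ($P>0$) means symmetric negative (positive) definite. The block matrix is symmetric with $(D+3)\times(D+3)$ blocks: all diagonal blocks equal $S$; below the diagonal the first block column consists of $AS+LY,\ \sigma_0A^DC_0Y,\dots,\sigma_DA^DC_DY$ and all other below-diagonal blocks are $0$. $D\ge 0$ is an integer (empty sums are zero), $x_t\in\mathbb{R}^n$ is the state, $u_t\in\mathbb{R}^m$ is the control input, and $A\in\mathbb{R}^{n\times n}$, $B_\tau,C_\tau\in\mathbb{R}^{n\times m}$ ($\tau=0,\dots,D$) are constant. The initial data $x_0$ and $u_t$, $t=-D,\dots,-1$, are given a priori (deterministic). Noise: $\{\omega_t^\tau\}_{t\ge0}$, $\tau=0,\dots,D$, are real random sequences, independent and identically distributed in time for each $\tau$ and mutually independent for different $\tau$, with $\mathbf{E}(\omega_t^\tau)=0$ and $\mathbf{E}(\omega_t^\tau\omega_s^\tau)=\sigma_\tau^2\delta_{ts}$ ($\delta_{ts}$ the Kronecker delta). Put $\omega_t=(\omega_t^0,\dots,\omega_t^D)'$ and $\mathcal{F}_t=\sigma\{\omega_s: 0\le s\le t\}$. Admissible controls: $\mathcal{U}_{ad}$ is the set of control processes $u$ such that $u_t$ is $\mathcal{F}_t$-measurable, $\sum_{t=0}^\infty\mathbf{E}(u_t'u_t)<\infty$, and $u_t=K_0x_t+\sum_{\tau=1}^DK_\tau u_{t-\tau}$ for all $t\ge 0$, for some constant matrices $K_0,\dots,K_D$ of compatible dimensions. (Such $u_t$ is then in fact $\mathcal{F}_{t-1}$-measurable.)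 Stabilizability: the system is asymptotically mean-square stabilizable if there exists a feedback control law (constant gains $K_0,\dots,K_D$) in $\mathcal{U}_{ad}$ such that the closed-loop system satisfies $\lim_{t\to\infty}\mathbf{E}(x_t'x_t)=0$ for any initial values $x_0$ and $u_t$, $t=-D,\dots,-1$. *)

theory Defs
  imports "HOL-Probability.Probability"
begin

(* The instance of power for the vec type multiplies entrywise, hence this definition. *)
primrec matpow :: "real^'n^'n \<Rightarrow> nat \<Rightarrow> real^'n^'n" where
  "matpow A 0 = mat 1"
| "matpow A (Suc k) = A ** matpow A k"

definition pos_def :: "real^'n^'n \<Rightarrow> bool" where
  "pos_def P \<longleftrightarrow> transpose P = P \<and> (\<forall>v. v \<noteq> 0 \<longrightarrow> v \<bullet> (P *v v) > 0)"

definition neg_def :: "real^'n^'n \<Rightarrow> bool" where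
  "neg_def S \<longleftrightarrow> transpose S = S \<and> (\<forall>v. v \<noteq> 0 \<longrightarrow> v \<bullet> (S *v v) < 0)"

(* A matrix of N times N square blocks is given by its blocks Q i j with i, j < N; it acts on
   vectors of N stacked blocks v 0, ..., v (N - 1). Values at indices \<ge> N are irrelevant. *)
definition block_neg_def :: "nat \<Rightarrow> (nat \<Rightarrow> nat \<Rightarrow> real^'n^'n) \<Rightarrow> bool" where
  "block_neg_def N Q \<longleftrightarrow>
     (\<forall>i<N. \<forall>j<N. Q j i = transpose (Q i j)) \<and>
     (\<forall>v :: nat \<Rightarrow> real^'n. (\<exists>i<N. v i \<noteq> 0) \<longrightarrow>
        (\<Sum>i<N. \<Sum>j<N. v i \<bullet> (Q i j *v v j)) < 0)"

definition Lmat :: "nat \<Rightarrow> real^'n^'n \<Rightarrow> (nat \<Rightarrow> real^'m^'n) \<Rightarrow> real^'m^'n" where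
  "Lmat D A B = (\<Sum>j\<le>D. matpow A (D - j) ** B j)"

(* Indices start at 0: row 1 of the first block column carries A S + L Y, and row \<tau> + 2
   carries the block of the noise with delay \<tau>, for \<tau> = 0, ..., D. *)
definition lmi_lower ::
  "nat \<Rightarrow> real^'n^'n \<Rightarrow> (nat \<Rightarrow> real^'m^'n) \<Rightarrow> (nat \<Rightarrow> real^'m^'n) \<Rightarrow> (nat \<Rightarrow> real)
    \<Rightarrow> real^'n^'m \<Rightarrow> real^'n^'n \<Rightarrow> nat \<Rightarrow> nat \<Rightarrow> real^'n^'n" where
  "lmi_lower D A B C \<sigma> Y S i j =
     (if j = 0 then
        (if i = 1 then A ** S + Lmat D A B ** Y
         else \<sigma> (i - 2) *\<^sub>R (matpow A D ** C (i - 2) ** Y))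
      else 0)"

definition lmi_matrix ::
  "nat \<Rightarrow> real^'n^'n \<Rightarrow> (nat \<Rightarrow> real^'m^'n) \<Rightarrow> (nat \<Rightarrow> real^'m^'n) \<Rightarrow> (nat \<Rightarrow> real)
    \<Rightarrow> real^'n^'m \<Rightarrow> real^'n^'n \<Rightarrow> nat \<Rightarrow> nat \<Rightarrow> real^'n^'n" where
  "lmi_matrix D A B C \<sigma> Y S i j =
     (if i = j then S
      else if j < i then lmi_lower D A B C \<sigma> Y S i j
      else transpose (lmi_lower D A B C \<sigma> Y S j i))"

(* \<omega> \<tau> t is the noise with delay index \<tau> at time t. Independence in time for each \<tau>
   together with mutual independence of the D + 1 sequences is joint independence of the whole
   family. Integrability is spelled out because non-integrable functions have integral 0. *)
definition noise_model ::
  "'w measure \<Rightarrow> nat \<Rightarrow> (nat \<Rightarrow> real) \<Rightarrow> (nat \<Rightarrow> nat \<Rightarrow> 'w \<Rightarrow> real) \<Rightarrow> bool" where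
  "noise_model M D \<sigma> \<omega> \<longleftrightarrow>
     prob_space M \<and>
     prob_space.indep_vars M (\<lambda>_. borel) (\<lambda>(\<tau>, t). \<omega> \<tau> t) ({..D} \<times> UNIV) \<and>
     (\<forall>\<tau>\<le>D. \<forall>t. distr M borel (\<omega> \<tau> t) = distr M borel (\<omega> \<tau> 0)) \<and>
     (\<forall>\<tau>\<le>D. \<forall>t. integrable M (\<omega> \<tau> t) \<and> integral\<^sup>L M (\<omega> \<tau> t) = 0) \<and>
     (\<forall>\<tau>\<le>D. \<forall>t s. integrable M (\<lambda>z. \<omega> \<tau> t z * \<omega> \<tau> s z) \<and>
        integral\<^sup>L M (\<lambda>z. \<omega> \<tau> t z * \<omega> \<tau> s z) = (if t = s then (\<sigma> \<tau>)\<^sup>2 else 0))"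

definition noise_sigma ::
  "'w measure \<Rightarrow> nat \<Rightarrow> (nat \<Rightarrow> nat \<Rightarrow> 'w \<Rightarrow> real) \<Rightarrow> nat \<Rightarrow> 'w measure" where
  "noise_sigma M D \<omega> t =
     sigma (space M)
       {\<omega> \<tau> s -` E \<inter> space M | \<tau> s E. \<tau> \<le> D \<and> s \<le> t \<and> E \<in> sets borel}"

(* Control processes are indexed by integers, as they include the initial inputs at times
   -D, ..., -1; values before -D are never used. *)
primrec state ::
  "nat \<Rightarrow> real^'n^'n \<Rightarrow> (nat \<Rightarrow> real^'m^'n) \<Rightarrow> (nat \<Rightarrow> real^'m^'n)
    \<Rightarrow> (nat \<Rightarrow> nat \<Rightarrow> 'w \<Rightarrow> real) \<Rightarrow> real^'n \<Rightarrow> (int \<Rightarrow> 'w \<Rightarrow> real^'m)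
    \<Rightarrow> nat \<Rightarrow> 'w \<Rightarrow> real^'n" where
  "state D A B C \<omega> x0 u 0 z = x0"
| "state D A B C \<omega> x0 u (Suc t) z =
     A *v state D A B C \<omega> x0 u t z +
     (\<Sum>\<tau>\<le>D. (B \<tau> + \<omega> \<tau> t z *\<^sub>R C \<tau>) *v u (int t - int \<tau>) z)"

definition feedback_law ::
  "'w measure \<Rightarrow> nat \<Rightarrow> real^'n^'m \<Rightarrow> (nat \<Rightarrow> real^'m^'m)
    \<Rightarrow> (nat \<Rightarrow> 'w \<Rightarrow> real^'n) \<Rightarrow> (int \<Rightarrow> 'w \<Rightarrow> real^'m) \<Rightarrow> bool" where
  "feedback_law M D K0 K x u \<longleftrightarrow>
     (\<forall>t. \<forall>z\<in>space M.
        u (int t) z = K0 *v x t z + (\<Sum>\<tau>=1..D. K \<tau> *v u (int t - int \<tau>) z))"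

definition U_ad ::
  "'w measure \<Rightarrow> nat \<Rightarrow> real^'n^'n \<Rightarrow> (nat \<Rightarrow> real^'m^'n) \<Rightarrow> (nat \<Rightarrow> real^'m^'n)
    \<Rightarrow> (nat \<Rightarrow> nat \<Rightarrow> 'w \<Rightarrow> real) \<Rightarrow> real^'n \<Rightarrow> (int \<Rightarrow> real^'m)
    \<Rightarrow> (int \<Rightarrow> 'w \<Rightarrow> real^'m) set" where
  "U_ad M D A B C \<omega> x0 u0 =
     {u. (\<forall>t\<in>{- int D..-1}. \<forall>z\<in>space M. u t z = u0 t) \<and>
         (\<forall>t. u (int t) \<in> noise_sigma M D \<omega> t \<rightarrow>\<^sub>M borel) \<and>
         (\<forall>t. integrable M (\<lambda>z. u (int t) z \<bullet> u (int t) z)) \<and>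
         summable (\<lambda>t. integral\<^sup>L M (\<lambda>z. u (int t) z \<bullet> u (int t) z)) \<and>
         (\<exists>K0 K. feedback_law M D K0 K (state D A B C \<omega> x0 u) u)}"

(* The gains are chosen before the initial data. For given gains and initial data the control
   u is uniquely determined on space M at all times \<ge> -D. *)
definition ms_stabilizable ::
  "'w measure \<Rightarrow> nat \<Rightarrow> real^'n^'n \<Rightarrow> (nat \<Rightarrow> real^'m^'n) \<Rightarrow> (nat \<Rightarrow> real^'m^'n)
    \<Rightarrow> (nat \<Rightarrow> nat \<Rightarrow> 'w \<Rightarrow> real) \<Rightarrow> bool" where
  "ms_stabilizable M D A B C \<omega> \<longleftrightarrow>
     (\<exists>K0 K. \<forall>x0 u0. \<exists>u \<in> U_ad M D A B C \<omega> x0 u0.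
        let x = state D A B C \<omega> x0 u in
          feedback_law M D K0 K x u \<and>
          (\<forall>t. integrable M (\<lambda>z. x t z \<bullet> x t z)) \<and>
          (\<lambda>t. integral\<^sup>L M (\<lambda>z. x t z \<bullet> x t z)) \<longlonglongrightarrow> 0)"

end

theory Submission
  imports Defs
begin

text \<open>
The inputs enter with delays, but a change of variables removes them from the drift. The predictor
\<open>y\<^sub>t = A\<^sup>D x\<^sub>t + \<Sum>\<^sub>j G\<^sub>j u\<^bsub>t-j\<^esub>\<close>, the conditional mean of the state \<open>D\<close> steps ahead if no further
inputs are applied,
satisfies
\<open>y\<^bsub>t+1\<^esub> = A y\<^sub>t + L u\<^sub>t + \<Sum>\<^sub>\<tau> \<omega>\<^sub>t\<^sup>\<tau> A\<^sup>D C\<^sub>\<tau> u\<^bsub>t-\<tau>\<^esub>\<close> (lemma \<open>predictor_step\<close>). Since \<open>A\<close> is invertible,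
controlling \<open>y\<close> and \<open>u\<close> is the same as controlling \<open>x\<close> and \<open>u\<close>. The delay survives only in the
noise, and there only second moments count: as the noise at time \<open>t\<close> is independent of everything
before it,
\<open>E y\<^bsub>t+1\<^esub>\<bullet>Qy\<^bsub>t+1\<^esub> = E (Ay\<^sub>t + Lu\<^sub>t)\<bullet>Q(Ay\<^sub>t + Lu\<^sub>t) + \<Sum>\<^sub>\<tau> E (R\<^sub>\<tau>u\<^bsub>t-\<tau>\<^esub>)\<bullet>Q(R\<^sub>\<tau>u\<^bsub>t-\<tau>\<^esub>)\<close> with
\<open>R\<^sub>\<tau> = \<sigma>\<^sub>\<tau> A\<^sup>D C\<^sub>\<tau>\<close> (lemma \<open>predictor_moment_step\<close>). Summed over time, the delays in these nonnegative
terms only cause boundary terms (lemma \<open>sum_shifted\<close>), so the system behaves like the delay-free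
system \<open>y\<^bsub>t+1\<^esub> = F y\<^sub>t + \<Sum>\<^sub>\<tau> \<omega>\<^sub>t\<^sup>\<tau> (A\<^sup>D C\<^sub>\<tau> K) y\<^sub>t\<close> with \<open>F = A + LK\<close>, whose mean-square stability is the
existence of \<open>P > 0\<close> with \<open>F'PF + \<Sum>\<^sub>\<tau> (R\<^sub>\<tau>K)'P(R\<^sub>\<tau>K) < P\<close>. Completing squares (a Schur complement)
turns this Lyapunov inequality into the linear matrix inequality in \<open>S = -P\<^sup>-\<^sup>1\<close>, \<open>Y = -KP\<^sup>-\<^sup>1\<close>
(lemma \<open>lmi_iff_lyap_feasible\<close>).

Sufficiency. The law \<open>u\<^sub>t = K y\<^sub>t\<close> is a feedback of the required form, and \<open>E y\<^sub>t\<bullet>Py\<^sub>t\<close> decreases up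
to the boundary terms, which bounds \<open>\<Sum>\<^sub>t E|y\<^sub>t|\<^sup>2\<close> (lemma \<open>summable_if_lyap_feasible\<close>).

Necessity. The stabilizing law may depend on \<open>x\<close> and past inputs in a way that is no function of \<open>y\<close>.
Only the second moments matter: run the closed loop from the states with \<open>y\<^sub>0 = e\<^sub>i\<close>, sum over \<open>i\<close>
and over a long finite time span, and let \<open>K\<close> be the least-squares gain of \<open>u\<close> on \<open>y\<close>. The
residual \<open>u - Ky\<close> is then orthogonal to \<open>y\<close>, so dropping it only lowers quadratic forms. Hence
\<open>\<phi>(Q) = \<Sum> E y\<bullet>Qy\<close> satisfies \<open>\<phi>(F'QF + \<Sum>\<^sub>\<tau> (R\<^sub>\<tau>K)'Q(R\<^sub>\<tau>K)) \<le> \<phi>(Q) - tr Q / 2\<close> for \<open>Q \<ge> 0\<close>, the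
trace coming from the start \<open>y\<^sub>0\<close> and the loss of one half from the end of the time span
(lemma \<open>lyap_feasible_if_vanishing\<close>). Thus \<open>\<phi>\<close> contracts geometrically along the iterates of the
Lyapunov operator on the identity, and a partial sum of these iterates is the desired \<open>P\<close>
(lemma \<open>lyap_feasible_if_contraction\<close>).
\<close>

section \<open>Quadratic forms\<close>

lemma inner_transpose: "(transpose (A :: real^'n^'m) *v x) \<bullet> y = x \<bullet> (A *v y)"
  by (simp add: dot_lmul_matrix)

lemma inner_symmetric_matrix:
  fixes Q :: "real^'n^'n"
  assumes "transpose Q = Q"
  shows "x \<bullet> (Q *v y) = y \<bullet> (Q *v x)"
  using inner_transpose[of Q x y] assms by (metis inner_commute)

lemma sum_matrix_vector_mult: "(\<Sum>i\<in>I. f i) *v x = (\<Sum>i\<in>I. (f i :: real^'n^'m) *v x)"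
  by (induction I rule: infinite_finite_induct) (simp_all add: matrix_vector_mult_add_rdistrib)

lemma matrix_vector_mult_sum: "(A :: real^'n^'m) *v (\<Sum>i\<in>I. f i) = (\<Sum>i\<in>I. A *v f i)"
  using linear_sum[OF matrix_vector_mul_linear] by blast

lemma matrix_vector_uminus: "(- (A :: real^'n^'m)) *v x = - (A *v x)"
  using scaleR_matrix_vector_assoc[of "-1" A x] by simp

lemma matrix_vector_mult_uminus: "(A :: real^'n^'m) *v (- x) = - (A *v x)"
  using matrix_vector_mult_scaleR[of A "-1" x] by simp

lemmas matvec_simps = matrix_vector_right_distrib matrix_vector_mult_add_rdistrib
  sum_matrix_vector_mult matrix_vector_mult_sum scaleR_matrix_vector_assoc[symmetric]
  matrix_vector_mult_scaleR
  matrix_vector_uminus matrix_vector_mult_uminus matrix_vector_mul_assoc[symmetric]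

lemma quadratic_form_add:
  fixes Q :: "real^'n^'n"
  assumes "transpose Q = Q"
  shows "(x + y) \<bullet> (Q *v (x + y)) = x \<bullet> (Q *v x) + 2 * (x \<bullet> (Q *v y)) + y \<bullet> (Q *v y)"
  using inner_symmetric_matrix[OF assms, of y x]
  by (simp add: matvec_simps inner_add_left inner_add_right)

definition pos_semidef :: "real^'n^'n \<Rightarrow> bool" where
  "pos_semidef Q \<longleftrightarrow> transpose Q = Q \<and> (\<forall>v. 0 \<le> v \<bullet> (Q *v v))"

lemma pos_def_imp_pos_semidef: "pos_def P \<Longrightarrow> pos_semidef P"
  unfolding pos_def_def pos_semidef_def by (metis inner_zero_left order_less_imp_le order_refl)

lemma trace_quadratic: "trace (Q :: real^'n^'n) = (\<Sum>i\<in>UNIV. axis i 1 \<bullet> (Q *v axis i 1))"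
  by (simp add: trace_def inner_axis' matrix_vector_mult_basis column_def)

text \<open>
Testing the form on \<open>v\<^sub>i e\<^sub>j - v\<^sub>j e\<^sub>i\<close> bounds each product \<open>2 v\<^sub>i v\<^sub>j Q\<^sub>i\<^sub>j\<close> by \<open>v\<^sub>i\<^sup>2 Q\<^sub>j\<^sub>j + v\<^sub>j\<^sup>2 Q\<^sub>i\<^sub>i\<close>; summing over
all \<open>i\<close>, \<open>j\<close> gives twice the claim. The trace thereby serves as the size of a positive semidefinite
matrix.
\<close>

lemma pos_semidef_le_trace:
  fixes Q :: "real^'n^'n"
  assumes "pos_semidef Q"
  shows "v \<bullet> (Q *v v) \<le> trace Q * (v \<bullet> v)"
proof -
  have entry: "axis i 1 \<bullet> (Q *v axis j 1) = Q $ i $ j" for i j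
    by (simp add: inner_axis' matrix_vector_mult_basis column_def)
  have sym: "Q $ i $ j = Q $ j $ i" for i j
    using assms unfolding pos_semidef_def by (metis transpose_def vec_lambda_beta)
  have minor: "2 * (v $ i * v $ j * Q $ i $ j) \<le> (v $ i)\<^sup>2 * Q $ j $ j + (v $ j)\<^sup>2 * Q $ i $ i"
    for i j
  proof -
    let ?w = "v $ i *\<^sub>R axis j 1 - v $ j *\<^sub>R axis i 1 :: real^'n"
    have "0 \<le> ?w \<bullet> (Q *v ?w)"
      using assms unfolding pos_semidef_def by blast
    also have "?w \<bullet> (Q *v ?w) = (v $ i)\<^sup>2 * Q $ j $ j + (v $ j)\<^sup>2 * Q $ i $ i
        - 2 * (v $ i * v $ j * Q $ i $ j)"
      using sym[of i j]
      by (simp add: matrix_vector_mult_diff_distrib matrix_vector_mult_scaleR inner_diff_left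
          inner_diff_right entry power2_eq_square algebra_simps)
    finally show ?thesis by simp
  qed
  have "2 * (v \<bullet> (Q *v v)) = (\<Sum>i\<in>UNIV. \<Sum>j\<in>UNIV. 2 * (v $ i * v $ j * Q $ i $ j))"
    by (simp add: inner_vec_def matrix_vector_mult_def sum_distrib_left algebra_simps)
  also have "\<dots> \<le> (\<Sum>i\<in>UNIV. \<Sum>j\<in>UNIV. (v $ i)\<^sup>2 * Q $ j $ j + (v $ j)\<^sup>2 * Q $ i $ i)"
    by (intro sum_mono minor)
  also have "\<dots> = 2 * ((\<Sum>j\<in>UNIV. Q $ j $ j) * (\<Sum>i\<in>UNIV. (v $ i)\<^sup>2))"
    unfolding sum.distrib sum.swap[of "\<lambda>i j. (v $ j)\<^sup>2 * Q $ i $ i"]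
    by (simp add: sum_distrib_left[symmetric] sum_distrib_right[symmetric] mult.commute)
  also have "\<dots> = 2 * (trace Q * (v \<bullet> v))"
    by (simp add: trace_def inner_vec_def power2_eq_square)
  finally show ?thesis by simp
qed

text \<open>
The form attains a positive minimum on the compact unit sphere.
\<close>

lemma pos_def_coercive:
  fixes W :: "real^'n^'n"
  assumes "\<And>v. v \<noteq> 0 \<Longrightarrow> 0 < v \<bullet> (W *v v)"
  obtains c where "c > 0" and "\<And>v. c * (v \<bullet> v) \<le> v \<bullet> (W *v v)"
proof -
  let ?S = "sphere (0 :: real^'n) 1"
  have ne: "?S \<noteq> {}" by simp
  have "continuous_on ?S (\<lambda>v. v \<bullet> (W *v v))"
    by (intro continuous_intros linear_continuous_on matrix_vector_mul_bounded_linear)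
  then obtain w where w: "w \<in> ?S" "\<And>v. v \<in> ?S \<Longrightarrow> w \<bullet> (W *v w) \<le> v \<bullet> (W *v v)"
    using continuous_attains_inf[OF compact_sphere ne] by blast
  show thesis
  proof
    show "0 < w \<bullet> (W *v w)" using assms[of w] w(1) by force
    show "w \<bullet> (W *v w) * (v \<bullet> v) \<le> v \<bullet> (W *v v)" for v
    proof (cases "v = 0")
      case False
      let ?u = "(1 / norm v) *\<^sub>R v"
      have "w \<bullet> (W *v w) \<le> ?u \<bullet> (W *v ?u)" using False by (intro w(2)) simp
      also have "\<dots> = (v \<bullet> (W *v v)) / (v \<bullet> v)"
        by (simp add: matrix_vector_mult_scaleR dot_square_norm power2_eq_square)
      finally show ?thesis using False by (simp add: pos_le_divide_eq)
    qed simp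
  qed
qed

lemma matrix_bounded_quadratic:
  fixes R :: "real^'n^'m"
  obtains c where "\<And>v. (R *v v) \<bullet> (R *v v) \<le> c * (v \<bullet> v)"
proof
  show "(R *v v) \<bullet> (R *v v) \<le> (onorm ((*v) R))\<^sup>2 * (v \<bullet> v)" for v
    using onorm[OF matrix_vector_mul_bounded_linear, of R v]
    by (metis dot_square_norm norm_ge_zero power_mono power_mult_distrib)
qed

lemma matrix_inv_cancel:
  fixes P :: "real^'n^'n"
  assumes "invertible P"
  shows "P ** matrix_inv P = mat 1" and "matrix_inv P ** P = mat 1"
  using assms unfolding invertible_def matrix_inv_def
  by (metis (mono_tags, lifting) someI_ex)+

lemma invertible_pos_def: "pos_def P \<Longrightarrow> invertible P"
  unfolding invertible_left_inverse matrix_left_invertible_ker pos_def_def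
  by (metis inner_zero_right less_irrefl)

section \<open>Lyapunov inequalities for matrices\<close>

text \<open>
The adjoint of the operator that maps the second moment matrix of \<open>y\<close> to that of \<open>F y + \<Sum>\<^sub>\<tau> w\<^sub>\<tau> G\<^sub>\<tau> y\<close>,
for uncorrelated centred \<open>w\<^sub>\<tau>\<close> of unit variance that are independent of \<open>y\<close>.
\<close>

definition lyap ::
  "nat \<Rightarrow> real^'n^'n \<Rightarrow> (nat \<Rightarrow> real^'n^'n) \<Rightarrow> real^'n^'n \<Rightarrow> real^'n^'n" where
  "lyap D F G Q = transpose F ** Q ** F + (\<Sum>\<tau>\<le>D. transpose (G \<tau>) ** Q ** G \<tau>)"

lemma lyap_quadratic:
  fixes F :: "real^'n^'n"
  shows "v \<bullet> (lyap D F G Q *v v) =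
     (F *v v) \<bullet> (Q *v (F *v v)) + (\<Sum>\<tau>\<le>D. (G \<tau> *v v) \<bullet> (Q *v (G \<tau> *v v)))"
proof -
  have "v \<bullet> (transpose H *v w) = (H *v v) \<bullet> w" for H :: "real^'n^'n" and w
    using inner_transpose[of H w v] by (simp add: inner_commute)
  then show ?thesis
    unfolding lyap_def by (simp add: matvec_simps inner_add_right inner_sum_right del: transpose_matrix_vector)
qed

lemma transpose_sum: "transpose (\<Sum>i\<in>I. f i) = (\<Sum>i\<in>I. transpose (f i :: real^'n^'m))"
  by (induction I rule: infinite_finite_induct)
    (simp_all add: transpose_def vec_eq_iff)

lemma transpose_add: "transpose (P + Q) = transpose P + transpose (Q :: real^'n^'m)"
  by (simp add: transpose_def vec_eq_iff)

lemma pos_semidef_lyap: "pos_semidef Q \<Longrightarrow> pos_semidef (lyap D F G Q)"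
proof -
  assume Q: "pos_semidef Q"
  have "transpose (lyap D F G Q) = lyap D F G Q"
    using Q by (simp add: pos_semidef_def lyap_def transpose_sum transpose_add
        matrix_transpose_mul matrix_mul_assoc)
  moreover have "0 \<le> v \<bullet> (lyap D F G Q *v v)" for v
    using Q unfolding lyap_quadratic pos_semidef_def
    by (intro add_nonneg_nonneg sum_nonneg) auto
  ultimately show ?thesis unfolding pos_semidef_def by blast
qed

definition lyap_feasible :: "nat \<Rightarrow> real^'n^'n \<Rightarrow> (nat \<Rightarrow> real^'n^'n) \<Rightarrow> real^'n^'n \<Rightarrow> bool" where
  "lyap_feasible D F G P \<longleftrightarrow>
     (\<forall>v. v \<noteq> 0 \<longrightarrow> v \<bullet> (lyap D F G P *v v) < v \<bullet> (P *v v))"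

text \<open>
The iterates \<open>Q\<^sub>t\<close> of the Lyapunov operator on the identity decay with \<open>\<phi>\<close>, so some \<open>Q\<^bsub>N+1\<^esub>\<close> has trace
below \<open>1\<close> and lies strictly below the identity \<open>Q\<^sub>0\<close>. For \<open>P = Q\<^sub>0 + \<dots> + Q\<^sub>N\<close> the operator shifts the
sum, whence its value at \<open>P\<close> is \<open>P + Q\<^bsub>N+1\<^esub> - Q\<^sub>0\<close>, which lies strictly below \<open>P\<close>. Stopping at a finite
\<open>N\<close> spares the limit of the series.
\<close>

lemma lyap_feasible_if_contraction:
  fixes F :: "real^'n^'n" and \<phi> :: "real^'n^'n \<Rightarrow> real"
  assumes trace_le: "\<And>Q. pos_semidef Q \<Longrightarrow> trace Q \<le> \<phi> Q"
    and contr: "\<And>Q. pos_semidef Q \<Longrightarrow> \<phi> (lyap D F G Q) \<le> \<rho> * \<phi> Q"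
    and \<rho>: "0 \<le> \<rho>" "\<rho> < 1"
  obtains P where "pos_def P" and "lyap_feasible D F G P"
proof -
  define Q where "Q t = (lyap D F G ^^ t) (mat 1)" for t
  have Q_Suc: "Q (Suc t) = lyap D F G (Q t)" for t
    by (simp add: Q_def)
  have psd: "pos_semidef (Q t)" for t
  proof (induction t)
    case 0
    show ?case by (simp add: Q_def pos_semidef_def)
  qed (simp add: Q_Suc pos_semidef_lyap)
  have decay: "\<phi> (Q t) \<le> \<rho> ^ t * \<phi> (Q 0)" for t
  proof (induction t)
    case (Suc t)
    have "\<phi> (Q (Suc t)) \<le> \<rho> * \<phi> (Q t)" unfolding Q_Suc by (rule contr[OF psd])
    also have "\<dots> \<le> \<rho> * (\<rho> ^ t * \<phi> (Q 0))" using Suc \<rho>(1) by (rule mult_left_mono)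
    finally show ?case by simp
  qed simp
  have "(\<lambda>t. \<rho> ^ t * \<phi> (Q 0)) \<longlonglongrightarrow> 0"
    using \<rho> by (intro tendsto_mult_left_zero LIMSEQ_realpow_zero)
  then have "eventually (\<lambda>t. \<rho> ^ t * \<phi> (Q 0) < 1) sequentially"
    by (rule order_tendstoD) simp
  then obtain N where N: "\<rho> ^ Suc N * \<phi> (Q 0) < 1"
    by (meson eventually_sequentially le_SucI order_refl)
  define P where "P = (\<Sum>t\<le>N. Q t)"
  have P_form: "v \<bullet> (P *v v) = (\<Sum>t\<le>N. v \<bullet> (Q t *v v))" for v
    by (simp add: P_def matvec_simps inner_sum_right)
  have nonneg: "0 \<le> v \<bullet> (Q t *v v)" for v t
    using psd unfolding pos_semidef_def by blast
  have "pos_def P"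
    unfolding pos_def_def
  proof (intro conjI allI impI)
    show "transpose P = P"
      using psd by (simp add: P_def transpose_sum pos_semidef_def)
    fix v :: "real^'n" assume "v \<noteq> 0"
    then have "0 < v \<bullet> (Q 0 *v v)" by (simp add: Q_def)
    also have "\<dots> \<le> v \<bullet> (P *v v)"
      unfolding P_form by (intro member_le_sum nonneg) auto
    finally show "0 < v \<bullet> (P *v v)" .
  qed
  moreover have "lyap_feasible D F G P"
    unfolding lyap_feasible_def
  proof (intro allI impI)
    fix v :: "real^'n" assume v: "v \<noteq> 0"
    have "v \<bullet> (lyap D F G P *v v) = (\<Sum>t\<le>N. v \<bullet> (lyap D F G (Q t) *v v))"
      unfolding lyap_quadratic P_form by (simp add: sum.distrib sum.swap[of _ _ "{..D}"])
    also have "\<dots> = (\<Sum>t\<le>N. v \<bullet> (Q (Suc t) *v v))" by (simp add: Q_Suc)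
    also have "\<dots> = v \<bullet> (P *v v) + v \<bullet> (Q (Suc N) *v v) - v \<bullet> (Q 0 *v v)"
      unfolding P_form sum.atMost_Suc_shift[symmetric]
      using sum.atMost_Suc_shift[of "\<lambda>t. v \<bullet> (Q t *v v)" N] sum.atMost_Suc[of "\<lambda>t. v \<bullet> (Q t *v v)" N]
      by linarith
    also have "v \<bullet> (Q (Suc N) *v v) < v \<bullet> (Q 0 *v v)"
    proof -
      have "trace (Q (Suc N)) < 1"
        using trace_le[OF psd, of "Suc N"] decay[of "Suc N"] N by linarith
      then have "trace (Q (Suc N)) * (v \<bullet> v) < v \<bullet> v" using v by simp
      then show ?thesis
        using pos_semidef_le_trace[OF psd, of v "Suc N"] by (simp add: Q_def)
    qed
    finally show "v \<bullet> (lyap D F G P *v v) < v \<bullet> (P *v v)" by simp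
  qed
  ultimately show thesis using that by blast
qed

section \<open>The linear matrix inequality\<close>

lemma arrow_block_quadratic_form:
  fixes S :: "real^'n^'n" and m :: "nat \<Rightarrow> real^'n^'n"
  assumes "\<And>i. i < Suc N \<Longrightarrow> Q i i = S"
    and "\<And>i. i < N \<Longrightarrow> Q (Suc i) 0 = m i"
    and "\<And>i. i < N \<Longrightarrow> Q 0 (Suc i) = transpose (m i)"
    and "\<And>i j. i < N \<Longrightarrow> j < N \<Longrightarrow> i \<noteq> j \<Longrightarrow> Q (Suc i) (Suc j) = 0"
  shows "(\<Sum>i<Suc N. \<Sum>j<Suc N. v i \<bullet> (Q i j *v v j)) =
    v 0 \<bullet> (S *v v 0) +
    (\<Sum>i<N. v (Suc i) \<bullet> (S *v v (Suc i)) + 2 * (v (Suc i) \<bullet> (m i *v v 0)))"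
proof -
  have tr: "v 0 \<bullet> (transpose (m i) *v v (Suc i)) = v (Suc i) \<bullet> (m i *v v 0)" for i
    using inner_transpose[of "m i" "v (Suc i)" "v 0"] by (simp add: inner_commute)
  have row: "(\<Sum>j<N. v (Suc i) \<bullet> (Q (Suc i) (Suc j) *v v (Suc j)))
      = v (Suc i) \<bullet> (S *v v (Suc i))" if i: "i < N" for i
  proof -
    have "(\<Sum>j<N. v (Suc i) \<bullet> (Q (Suc i) (Suc j) *v v (Suc j)))
      = (\<Sum>j<N. if i = j then v (Suc i) \<bullet> (S *v v (Suc i)) else 0)"
      using i assms(1)[of "Suc i"] assms(4)[of i] by (intro sum.cong) auto
    then show ?thesis using i by simp
  qed
  have "(\<Sum>i<Suc N. \<Sum>j<Suc N. v i \<bullet> (Q i j *v v j)) =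
      v 0 \<bullet> (S *v v 0) + (\<Sum>i<N. v (Suc i) \<bullet> (m i *v v 0)) +
      (\<Sum>i<N. v (Suc i) \<bullet> (m i *v v 0) + v (Suc i) \<bullet> (S *v v (Suc i)))"
    unfolding sum.lessThan_Suc_shift
    using assms(1)[of 0] assms(2,3) row by (simp add: tr del: transpose_matrix_vector)
  then show ?thesis by (simp add: sum.distrib sum_distrib_left[symmetric])
qed

lemma lmi_quadratic_form:
  fixes A :: "real^'n^'n" and B C :: "nat \<Rightarrow> real^'m^'n"
  assumes S: "S = - matrix_inv P" and Y: "Y = - (K ** matrix_inv P)"
  shows "(\<Sum>i<D + 3. \<Sum>j<D + 3. v i \<bullet> (lmi_matrix D A B C \<sigma> Y S i j *v v j)) =
    - (v 0 \<bullet> (matrix_inv P *v v 0))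
    - (v 1 \<bullet> (matrix_inv P *v v 1)
       + 2 * (v 1 \<bullet> ((A + Lmat D A B ** K) *v (matrix_inv P *v v 0))))
    - (\<Sum>\<tau>\<le>D. v (\<tau> + 2) \<bullet> (matrix_inv P *v v (\<tau> + 2))
       + 2 * (v (\<tau> + 2) \<bullet> ((\<sigma> \<tau> *\<^sub>R (matpow A D ** C \<tau> ** K)) *v (matrix_inv P *v v 0))))"
proof -
  let ?m = "\<lambda>i. lmi_lower D A B C \<sigma> Y S (Suc i) 0"
  have "(\<Sum>i<Suc (D + 2). \<Sum>j<Suc (D + 2). v i \<bullet> (lmi_matrix D A B C \<sigma> Y S i j *v v j)) =
    v 0 \<bullet> (S *v v 0) +
    (\<Sum>i<D + 2. v (Suc i) \<bullet> (S *v v (Suc i)) + 2 * (v (Suc i) \<bullet> (?m i *v v 0)))"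
    by (rule arrow_block_quadratic_form)
      (auto simp: lmi_matrix_def lmi_lower_def transpose_def vec_eq_iff)
  also have "(\<Sum>i<D + 2. v (Suc i) \<bullet> (S *v v (Suc i)) + 2 * (v (Suc i) \<bullet> (?m i *v v 0))) =
      (v 1 \<bullet> (S *v v 1) + 2 * (v 1 \<bullet> (?m 0 *v v 0))) +
      (\<Sum>\<tau>\<le>D. v (\<tau> + 2) \<bullet> (S *v v (\<tau> + 2)) + 2 * (v (\<tau> + 2) \<bullet> (?m (Suc \<tau>) *v v 0)))"
    using sum.lessThan_Suc_shift[of "\<lambda>i. v (Suc i) \<bullet> (S *v v (Suc i)) + 2 * (v (Suc i) \<bullet> (?m i *v v 0))" "Suc D"]
    by (simp add: lessThan_Suc_atMost)
  finally show ?thesis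
    by (simp add: lmi_lower_def S Y matvec_simps algebra_simps inner_diff_right inner_add_right
        sum_negf sum_subtractf sum.distrib numeral_3_eq_3)
qed

text \<open>
Expand \<open>0 \<le> (u + w)\<bullet>P(u + w)\<close> at \<open>v = P u\<close>. Equality holds at \<open>v = -P w\<close>; both facts together make
the Lyapunov inequality the result of eliminating the lower blocks from the linear matrix inequality.
\<close>

lemma complete_square_le:
  fixes P :: "real^'n^'n"
  assumes P: "pos_def P"
  shows "- (v \<bullet> (matrix_inv P *v v) + 2 * (v \<bullet> w)) \<le> w \<bullet> (P *v w)"
proof -
  let ?X = "matrix_inv P"
  obtain u where u: "v = P *v u"
    using matrix_inv_cancel[OF invertible_pos_def[OF P]]
    by (metis matrix_vector_mul_assoc matrix_vector_mul_lid)
  have "?X *v v = u"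
    unfolding u using matrix_inv_cancel[OF invertible_pos_def[OF P]]
    by (metis matrix_vector_mul_assoc matrix_vector_mul_lid)
  moreover have "0 \<le> (u + w) \<bullet> (P *v (u + w))"
    using pos_def_imp_pos_semidef[OF P] by (simp add: pos_semidef_def)
  moreover have "transpose P = P" using P by (simp add: pos_def_def)
  ultimately show ?thesis
    using quadratic_form_add[of P u w] inner_symmetric_matrix[of P u w]
    by (simp add: u inner_commute)
qed

lemma pos_def_matrix_inv:
  fixes P :: "real^'n^'n"
  assumes P: "pos_def P"
  shows "pos_def (matrix_inv P)"
proof -
  let ?X = "matrix_inv P"
  note inv = matrix_inv_cancel[OF invertible_pos_def[OF P]]
  have tP: "transpose P = P" using P by (simp add: pos_def_def)
  have PX: "P *v (?X *v v) = v" for v by (simp add: matrix_vector_mul_assoc inv)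
  have "transpose ?X ** P = mat 1"
    using arg_cong[OF inv(1), of transpose] by (simp add: matrix_transpose_mul tP)
  then have "transpose ?X = ?X"
    by (metis inv(1) matrix_mul_assoc matrix_mul_lid matrix_mul_rid)
  moreover have "0 < v \<bullet> (?X *v v)" if "v \<noteq> 0" for v
  proof -
    have "?X *v v \<noteq> 0" using PX[of v] that by (metis matrix_vector_mult_0_right)
    then have "0 < (?X *v v) \<bullet> (P *v (?X *v v))" using P by (simp add: pos_def_def)
    then show ?thesis by (simp add: PX inner_commute)
  qed
  ultimately show ?thesis by (simp add: pos_def_def)
qed

text \<open>
With \<open>v\<^sub>0 = P w\<close>, maximizing the block form over \<open>v\<^sub>1, v\<^sub>2, \<dots>\<close> leaves the Lyapunov form minus \<open>P\<close> at
\<open>w\<close>. The maximizing blocks are the test vector in one direction, and the maximum is the bound in the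
other.
\<close>

lemma lmi_iff_lyap_feasible:
  fixes A :: "real^'n^'n" and B C :: "nat \<Rightarrow> real^'m^'n" and K :: "real^'n^'m"
  assumes P: "pos_def P"
    and S: "S = - matrix_inv P" and Y: "Y = - (K ** matrix_inv P)"
  shows "block_neg_def (D + 3) (lmi_matrix D A B C \<sigma> Y S) \<longleftrightarrow>
    lyap_feasible D (A + Lmat D A B ** K) (\<lambda>\<tau>. \<sigma> \<tau> *\<^sub>R (matpow A D ** C \<tau> ** K)) P"
proof -
  let ?X = "matrix_inv P"
  let ?F = "A + Lmat D A B ** K" and ?G = "\<lambda>\<tau>. \<sigma> \<tau> *\<^sub>R (matpow A D ** C \<tau> ** K)"
  note inv = matrix_inv_cancel[OF invertible_pos_def[OF P]]
  have X: "pos_def ?X" by (rule pos_def_matrix_inv[OF P])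
  have PX: "P *v (?X *v v) = v" and XP: "?X *v (P *v v) = v" for v
    by (simp_all add: matrix_vector_mul_assoc inv)
  note form = lmi_quadratic_form[OF S Y, where D=D and A=A and B=B and C=C and \<sigma>=\<sigma>]
  have "transpose S = S"
    using X by (simp add: S pos_def_def transpose_def vec_eq_iff)
  then have sym: "lmi_matrix D A B C \<sigma> Y S j i = transpose (lmi_matrix D A B C \<sigma> Y S i j)" for i j
    by (auto simp: lmi_matrix_def)
  show ?thesis
  proof
    assume neg: "block_neg_def (D + 3) (lmi_matrix D A B C \<sigma> Y S)"
    show "lyap_feasible D ?F ?G P"
      unfolding lyap_feasible_def
    proof (intro allI impI)
      fix w :: "real^'n" assume w: "w \<noteq> 0"
      \<comment> \<open>the blocks at which the squares of the lower rows vanish\<close>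
      define v where "v i = (if i = 0 then P *v w else if i = 1 then - (P *v (?F *v w))
        else - (P *v (?G (i - 2) *v w)))" for i :: nat
      have "P *v w \<noteq> 0" using XP[of w] w by (metis matrix_vector_mult_0_right)
      then have "\<exists>i<D + 3. v i \<noteq> 0" by (intro exI[of _ 0]) (simp add: v_def)
      then have "(\<Sum>i<D + 3. \<Sum>j<D + 3. v i \<bullet> (lmi_matrix D A B C \<sigma> Y S i j *v v j)) < 0"
        using neg unfolding block_neg_def_def by blast
      also have "(\<Sum>i<D + 3. \<Sum>j<D + 3. v i \<bullet> (lmi_matrix D A B C \<sigma> Y S i j *v v j)) =
        w \<bullet> (lyap D ?F ?G P *v w) - w \<bullet> (P *v w)"
        unfolding form lyap_quadratic
        by (simp add: v_def XP matrix_vector_mult_uminus inner_commute[of "P *v _"]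
            sum_negf)
      finally show "w \<bullet> (lyap D ?F ?G P *v w) < w \<bullet> (P *v w)" by simp
    qed
  next
    assume feas: "lyap_feasible D ?F ?G P"
    show "block_neg_def (D + 3) (lmi_matrix D A B C \<sigma> Y S)"
      unfolding block_neg_def_def
    proof (intro conjI allI impI)
      show "lmi_matrix D A B C \<sigma> Y S j i = transpose (lmi_matrix D A B C \<sigma> Y S i j)" for i j
        by (rule sym)
      fix v :: "nat \<Rightarrow> real^'n"
      assume nz: "\<exists>i<D + 3. v i \<noteq> 0"
      show "(\<Sum>i<D + 3. \<Sum>j<D + 3. v i \<bullet> (lmi_matrix D A B C \<sigma> Y S i j *v v j)) < 0"
      proof (cases "v 0 = 0")
        case True
        have nonneg: "0 \<le> u \<bullet> (?X *v u)" for u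
          using pos_def_imp_pos_semidef[OF X] by (simp add: pos_semidef_def)
        obtain i where i: "i < D + 3" "v i \<noteq> 0" using nz by blast
        have pos: "0 < v i \<bullet> (?X *v v i)" using X i(2) by (simp add: pos_def_def)
        have "0 < v 1 \<bullet> (?X *v v 1) + (\<Sum>\<tau>\<le>D. v (\<tau> + 2) \<bullet> (?X *v v (\<tau> + 2)))"
        proof (cases "i = 1")
          case True
          then show ?thesis using pos by (intro add_pos_nonneg sum_nonneg nonneg) auto
        next
          case False
          have "i \<noteq> 0" using i True by metis
          then have *: "i = (i - 2) + 2" "i - 2 \<le> D" using False i(1) by auto
          have "0 < (\<Sum>\<tau>\<le>D. v (\<tau> + 2) \<bullet> (?X *v v (\<tau> + 2)))"
            using * pos by (intro sum_pos2[of _ "i - 2"] nonneg) auto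
          then show ?thesis using nonneg[of "v 1"] by simp
        qed
        then show ?thesis unfolding form True by simp
      next
        case False
        define w where "w = ?X *v v 0"
        have v0: "v 0 = P *v w" by (simp add: w_def PX)
        then have "w \<noteq> 0" using False by auto
        then have "w \<bullet> (lyap D ?F ?G P *v w) < w \<bullet> (P *v w)"
          using feas by (simp add: lyap_feasible_def)
        moreover have "- (v 1 \<bullet> (?X *v v 1) + 2 * (v 1 \<bullet> (?F *v w))) \<le> (?F *v w) \<bullet> (P *v (?F *v w))"
          by (rule complete_square_le[OF P])
        moreover have "- (\<Sum>\<tau>\<le>D. v (\<tau> + 2) \<bullet> (?X *v v (\<tau> + 2)) + 2 * (v (\<tau> + 2) \<bullet> (?G \<tau> *v w)))
            \<le> (\<Sum>\<tau>\<le>D. (?G \<tau> *v w) \<bullet> (P *v (?G \<tau> *v w)))"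
          unfolding sum_negf[symmetric] by (intro sum_mono complete_square_le[OF P])
        ultimately show ?thesis
          unfolding form w_def[symmetric] lyap_quadratic by (simp add: v0 inner_commute)
      qed
    qed
  qed
qed

section \<open>The predictor\<close>

lemma matpow_commute: "matpow A k ** A = A ** matpow A k"
  by (induction k) (simp_all add: matrix_mul_assoc[symmetric])

lemma invertible_matpow: "invertible A \<Longrightarrow> invertible (matpow A k)"
proof (induction k)
  case 0
  show ?case unfolding invertible_def matpow.simps by (rule exI[of _ "mat 1"]) simp
qed (simp add: invertible_mult)

text \<open>
An input at delay \<open>j\<close> before the present reaches the state \<open>D\<close> steps ahead through every \<open>B\<^sub>k\<close> with
\<open>k \<ge> j\<close>: it acts \<open>k - j\<close> steps after the present and is then carried on by the remaining
\<open>D - 1 - (k - j)\<close> powers of \<open>A\<close>. For \<open>j > D\<close> the gain is zero.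
\<close>

definition predictor_gain :: "nat \<Rightarrow> real^'n^'n \<Rightarrow> (nat \<Rightarrow> real^'m^'n) \<Rightarrow> nat \<Rightarrow> real^'m^'n" where
  "predictor_gain D A B j = (\<Sum>k=j..D. matpow A (D + j - 1 - k) ** B k)"

definition predictor ::
  "nat \<Rightarrow> real^'n^'n \<Rightarrow> (nat \<Rightarrow> real^'m^'n) \<Rightarrow> (nat \<Rightarrow> 'w \<Rightarrow> real^'n)
    \<Rightarrow> (int \<Rightarrow> 'w \<Rightarrow> real^'m) \<Rightarrow> nat \<Rightarrow> 'w \<Rightarrow> real^'n" where
  "predictor D A B x u t z =
     matpow A D *v x t z + (\<Sum>j=1..D. predictor_gain D A B j *v u (int t - int j) z)"

lemma matrix_mul_sum: "A ** (\<Sum>i\<in>I. f i) = (\<Sum>i\<in>I. A ** (f i :: real^'n^'m))"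
  for A :: "real^'m^'l"
  by (induction I rule: infinite_finite_induct) (simp_all add: matrix_add_ldistrib)

text \<open>
This is what makes the predictor telescope: one step of \<open>A\<close> moves an input from delay \<open>j\<close> to delay
\<open>j + 1\<close>, up to the share \<open>A\<^sup>D B\<^sub>j\<close> that enters the state in that step.
\<close>

lemma predictor_gain_recurrence:
  assumes "1 \<le> j" "j \<le> D"
  shows "A ** predictor_gain D A B j = matpow A D ** B j + predictor_gain D A B (Suc j)"
proof -
  have "A ** predictor_gain D A B j = (\<Sum>k=j..D. matpow A (D + j - k) ** B k)"
    unfolding predictor_gain_def matrix_mul_sum
  proof (rule sum.cong[OF refl])
    fix k assume "k \<in> {j..D}"
    then have "D + j - k = Suc (D + j - 1 - k)" using assms by auto
    then show "A ** (matpow A (D + j - 1 - k) ** B k) = matpow A (D + j - k) ** B k"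
      by (simp add: matrix_mul_assoc)
  qed
  also have "\<dots> = matpow A D ** B j + (\<Sum>k=Suc j..D. matpow A (D + j - k) ** B k)"
    using assms by (simp add: sum.atLeast_Suc_atMost)
  finally show ?thesis by (simp add: predictor_gain_def)
qed

lemma Lmat_eq_predictor_gain: "Lmat D A B = matpow A D ** B 0 + predictor_gain D A B 1"
  by (simp add: Lmat_def predictor_gain_def atMost_atLeast0 sum.atLeast_Suc_atMost)

lemma predictor_step:
  fixes A :: "real^'n^'n" and B C :: "nat \<Rightarrow> real^'m^'n"
  shows "predictor D A B (state D A B C \<omega> x0 u) u (Suc t) z =
    A *v predictor D A B (state D A B C \<omega> x0 u) u t z + Lmat D A B *v u (int t) z +
    (\<Sum>\<tau>\<le>D. \<omega> \<tau> t z *\<^sub>R ((matpow A D ** C \<tau>) *v u (int t - int \<tau>) z))"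
proof -
  let ?G = "predictor_gain D A B" and ?x = "state D A B C \<omega> x0 u t z"
  let ?u = "\<lambda>j. u (int t - int j) z"
  \<comment> \<open>index shift; the term \<open>j = D\<close> of the final sum has gain zero\<close>
  have "(\<Sum>j=1..D. ?G j *v u (int (Suc t) - int j) z) = (\<Sum>j<D. ?G (Suc j) *v ?u j)"
    by (rule sum.reindex_bij_witness[of _ Suc "\<lambda>j. j - 1"]) (auto simp: of_nat_diff algebra_simps)
  also have "\<dots> = (\<Sum>j\<le>D. ?G (Suc j) *v ?u j)"
    by (simp add: lessThan_Suc_atMost[symmetric] predictor_gain_def)
  finally have shift: "(\<Sum>j=1..D. ?G j *v u (int (Suc t) - int j) z) = (\<Sum>j\<le>D. ?G (Suc j) *v ?u j)" .
  have "A *v (\<Sum>j=1..D. ?G j *v ?u j) = (\<Sum>j=1..D. (matpow A D ** B j + ?G (Suc j)) *v ?u j)"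
    unfolding matrix_vector_mult_sum
    by (intro sum.cong refl) (simp add: matrix_vector_mul_assoc predictor_gain_recurrence)
  then have "A *v predictor D A B (state D A B C \<omega> x0 u) u t z + Lmat D A B *v u (int t) z =
      (A ** matpow A D) *v ?x + (\<Sum>j\<le>D. (matpow A D ** B j + ?G (Suc j)) *v ?u j)"
    unfolding predictor_def
    by (simp add: matrix_vector_right_distrib matrix_vector_mul_assoc Lmat_eq_predictor_gain
        atMost_atLeast0 sum.atLeast_Suc_atMost)
  then show ?thesis
    unfolding predictor_def shift
    by (simp add: matvec_simps matpow_commute sum.distrib)
      (simp add: matrix_vector_mul_assoc matpow_commute)
qed

section \<open>Second moments driven by independent noise\<close>

locale delayed_noise =
  fixes M :: "'w measure" and D :: nat and \<sigma> :: "nat \<Rightarrow> real" and \<omega> :: "nat \<Rightarrow> nat \<Rightarrow> 'w \<Rightarrow> real"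
  assumes noise: "noise_model M D \<sigma> \<omega>"

sublocale delayed_noise \<subseteq> prob_space M
  using noise by (simp add: noise_model_def)

context delayed_noise
begin

text \<open>
The pairs in the index set are (delay index, time). Arbitrary index sets are admitted because
independence is needed for disjoint ones: the past against the present noise, and two noise terms of
the same time against each other.
\<close>

definition noise_field :: "(nat \<times> nat) set \<Rightarrow> 'w measure" where
  "noise_field I =
     sigma (space M) (\<Union>i\<in>I. {\<omega> (fst i) (snd i) -` E \<inter> space M | E. E \<in> sets borel})"

abbreviation past :: "nat \<Rightarrow> 'w measure" where
  "past t \<equiv> noise_field ({..D} \<times> {..<t})"

lemma noise_measurable: "\<tau> \<le> D \<Longrightarrow> \<omega> \<tau> t \<in> borel_measurable M"
  using noise unfolding noise_model_def by (metis borel_measurable_integrable)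

lemma space_noise_field [simp]: "space (noise_field I) = space M"
  unfolding noise_field_def by (rule space_measure_of) auto

lemma sets_noise_field:
  "sets (noise_field I) =
     sigma_sets (space M) (\<Union>i\<in>I. {\<omega> (fst i) (snd i) -` E \<inter> space M | E. E \<in> sets borel})"
  unfolding noise_field_def by (rule sets_measure_of) auto

lemma subalgebra_noise_field:
  assumes "I \<subseteq> {..D} \<times> UNIV"
  shows "subalgebra M (noise_field I)"
proof -
  have "sets (noise_field I) \<subseteq> sets M"
    unfolding sets_noise_field using assms noise_measurable
    by (intro sets.sigma_sets_subset) (auto intro!: measurable_sets[of _ M borel])
  then show ?thesis by (simp add: subalgebra_def)
qed

lemma noise_field_mono:
  assumes "I \<subseteq> J" "f \<in> measurable (noise_field I) N"
  shows "f \<in> measurable (noise_field J) N"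
proof (rule measurable_from_subalg[OF _ assms(2)])
  have "sets (noise_field I) \<subseteq> sets (noise_field J)"
    unfolding sets_noise_field using assms(1) by (intro sigma_sets_mono') blast
  then show "subalgebra (noise_field J) (noise_field I)" by (simp add: subalgebra_def)
qed

lemma noise_field_measurable: "(\<tau>, t) \<in> I \<Longrightarrow> \<omega> \<tau> t \<in> borel_measurable (noise_field I)"
  by (rule measurableI) (auto simp: sets_noise_field intro!: sigma_sets.Basic bexI[of _ "(\<tau>, t)"] exI)

lemma noise_sigma_eq: "noise_sigma M D \<omega> t = noise_field ({..D} \<times> {..t})"
proof -
  have "{\<omega> \<tau> s -` E \<inter> space M | \<tau> s E. \<tau> \<le> D \<and> s \<le> t \<and> E \<in> sets borel} =
    (\<Union>i\<in>{..D} \<times> {..t}. {\<omega> (fst i) (snd i) -` E \<inter> space M | E. E \<in> sets borel})"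
    by fastforce
  then show ?thesis unfolding noise_sigma_def noise_field_def by simp
qed

text \<open>
The generators, preimages of Borel sets under single noise variables, are stable under intersection.
Independence therefore passes from the family of noise variables to the sigma algebras that disjoint
subfamilies generate.
\<close>

lemma indep_var_noise_field:
  fixes f g :: "'w \<Rightarrow> real"
  assumes f: "f \<in> borel_measurable (noise_field I)" and g: "g \<in> borel_measurable (noise_field J)"
    and IJ: "I \<subseteq> {..D} \<times> UNIV" "J \<subseteq> {..D} \<times> UNIV" "I \<inter> J = {}"
  shows "indep_var borel f borel g"
proof -
  let ?E = "\<lambda>i. {\<omega> (fst i) (snd i) -` E \<inter> space M | E. E \<in> sets borel}"
  have "indep_sets ?E ({..D} \<times> UNIV)"
    using noise unfolding noise_model_def indep_vars_def2 by (simp add: case_prod_beta)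
  then have indep: "indep_sets ?E (\<Union>b\<in>UNIV. case_bool I J b)"
    using IJ by (rule_tac indep_sets_mono_index) (auto split: bool.splits)
  have "indep_sets (\<lambda>b. sigma_sets (space M) (\<Union>i\<in>case_bool I J b. ?E i)) UNIV"
  proof (rule indep_sets_collect_sigma[OF indep])
    show "Int_stable (?E i)" for i
      unfolding Int_stable_def
      by (auto, rename_tac E E', rule_tac x="E \<inter> E'" in exI) auto
    show "disjoint_family_on (case_bool I J) UNIV"
      using IJ(3) by (auto simp: disjoint_family_on_def split: bool.splits)
  qed
  then have sets: "indep_set (sets (noise_field I)) (sets (noise_field J))"
    unfolding indep_set_def sets_noise_field
    by (rule indep_sets_mono_sets) (auto split: bool.splits)
  have gen: "sigma_sets (space M) {h -` A \<inter> space M | A. A \<in> sets borel} \<subseteq> sets (noise_field K)"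
    if "h \<in> borel_measurable (noise_field K)" for h :: "'w \<Rightarrow> real" and K
    using sets.sigma_sets_subset[of "{h -` A \<inter> space M | A. A \<in> sets borel}" "noise_field K"]
      measurable_sets[OF that] by auto
  show ?thesis
    unfolding indep_var_eq
  proof (intro conjI)
    show "random_variable borel f" "random_variable borel g"
      by (rule measurable_from_subalg[OF subalgebra_noise_field[OF IJ(1)] f],
          rule measurable_from_subalg[OF subalgebra_noise_field[OF IJ(2)] g])
    show "indep_set (sigma_sets (space M) {f -` A \<inter> space M | A. A \<in> sets borel})
       (sigma_sets (space M) {g -` A \<inter> space M | A. A \<in> sets borel})"
      using sets unfolding indep_set_def
      by (rule indep_sets_mono_sets) (use gen[OF f] gen[OF g] in \<open>auto split: bool.splits\<close>)
  qed
qed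

lemma noise_product:
  assumes "\<tau> \<le> D" "\<rho> \<le> D"
  shows "integrable M (\<lambda>z. \<omega> \<tau> t z * \<omega> \<rho> t z)"
    and "expectation (\<lambda>z. \<omega> \<tau> t z * \<omega> \<rho> t z) = (if \<tau> = \<rho> then (\<sigma> \<tau>)\<^sup>2 else 0)"
proof -
  have same: "integrable M (\<lambda>z. \<omega> \<tau> t z * \<omega> \<tau> t z)"
      "expectation (\<lambda>z. \<omega> \<tau> t z * \<omega> \<tau> t z) = (\<sigma> \<tau>)\<^sup>2"
    and mean: "integrable M (\<omega> \<tau> t)" "expectation (\<omega> \<tau> t) = 0" "integrable M (\<omega> \<rho> t)"
    using noise assms unfolding noise_model_def by auto
  have indep: "indep_var borel (\<omega> \<tau> t) borel (\<omega> \<rho> t)" if "\<tau> \<noteq> \<rho>"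
    using assms that
    by (intro indep_var_noise_field[of _ "{(\<tau>, t)}" _ "{(\<rho>, t)}"] noise_field_measurable) auto
  show "integrable M (\<lambda>z. \<omega> \<tau> t z * \<omega> \<rho> t z)"
    using same indep_var_integrable[OF indep mean(1,3)] by (cases "\<tau> = \<rho>") auto
  show "expectation (\<lambda>z. \<omega> \<tau> t z * \<omega> \<rho> t z) = (if \<tau> = \<rho> then (\<sigma> \<tau>)\<^sup>2 else 0)"
    using same indep_var_lebesgue_integral[OF indep mean(1,3)] mean(2) by (cases "\<tau> = \<rho>") auto
qed

lemma past_times_noise:
  fixes f :: "'w \<Rightarrow> real"
  assumes f: "f \<in> borel_measurable (past t)" "integrable M f" and \<tau>: "\<tau> \<le> D"
  shows "integrable M (\<lambda>z. \<omega> \<tau> t z * f z)" and "expectation (\<lambda>z. \<omega> \<tau> t z * f z) = 0"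
proof -
  have \<omega>: "integrable M (\<omega> \<tau> t)" "expectation (\<omega> \<tau> t) = 0"
    using noise \<tau> unfolding noise_model_def by auto
  have "indep_var borel (\<omega> \<tau> t) borel f"
    using \<tau> by (intro indep_var_noise_field[OF noise_field_measurable[of _ _ "{(\<tau>, t)}"] f(1)]) auto
  then show "integrable M (\<lambda>z. \<omega> \<tau> t z * f z)" "expectation (\<lambda>z. \<omega> \<tau> t z * f z) = 0"
    using indep_var_integrable[OF _ \<omega>(1) f(2)] indep_var_lebesgue_integral[OF _ \<omega>(1) f(2)] \<omega>(2)
    by auto
qed

lemma past_times_noise_product:
  fixes f :: "'w \<Rightarrow> real"
  assumes f: "f \<in> borel_measurable (past t)" "integrable M f" and \<tau>: "\<tau> \<le> D" "\<rho> \<le> D"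
  shows "integrable M (\<lambda>z. \<omega> \<tau> t z * \<omega> \<rho> t z * f z)"
    and "expectation (\<lambda>z. \<omega> \<tau> t z * \<omega> \<rho> t z * f z) =
      (if \<tau> = \<rho> then (\<sigma> \<tau>)\<^sup>2 * expectation f else 0)"
proof -
  have "indep_var borel (\<lambda>z. \<omega> \<tau> t z * \<omega> \<rho> t z) borel f"
    using \<tau> by (intro indep_var_noise_field[OF _ f(1), of _ "{(\<tau>, t), (\<rho>, t)}"]
        borel_measurable_times noise_field_measurable) auto
  then show "integrable M (\<lambda>z. \<omega> \<tau> t z * \<omega> \<rho> t z * f z)"
    "expectation (\<lambda>z. \<omega> \<tau> t z * \<omega> \<rho> t z * f z) =
      (if \<tau> = \<rho> then (\<sigma> \<tau>)\<^sup>2 * expectation f else 0)"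
    using indep_var_integrable[OF _ noise_product(1)[OF \<tau>] f(2)]
      indep_var_lebesgue_integral[OF _ noise_product(1)[OF \<tau>] f(2)] noise_product(2)[OF \<tau>] by auto
qed

text \<open>
Strict past: the noise of time \<open>t\<close> itself is excluded. A feedback input \<open>u\<^sub>t\<close> has this property
at time \<open>t\<close>, which is more than being adapted to the noise up to \<open>t\<close>, and is what the independence
argument needs.
\<close>

definition past_L2 :: "nat \<Rightarrow> ('w \<Rightarrow> real^'k) \<Rightarrow> bool" where
  "past_L2 t f \<longleftrightarrow> f \<in> borel_measurable (past t) \<and> integrable M (\<lambda>z. f z \<bullet> f z)"

lemma past_measurable:
  assumes "f \<in> borel_measurable (past t)"
  shows "f \<in> borel_measurable M"
  by (rule measurable_from_subalg[OF subalgebra_noise_field assms]) auto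

lemma past_L2_const: "past_L2 t (\<lambda>_. c)"
  by (simp add: past_L2_def)

lemma past_L2_Suc: "past_L2 t f \<Longrightarrow> past_L2 (Suc t) f"
  unfolding past_L2_def by (auto elim: noise_field_mono[rotated])

lemma past_L2_mono: "past_L2 s f \<Longrightarrow> s \<le> t \<Longrightarrow> past_L2 t f"
  by (induction t) (auto simp: le_Suc_eq past_L2_Suc)

lemma past_L2_inner:
  assumes "past_L2 t f" "past_L2 t g"
  shows "(\<lambda>z. f z \<bullet> g z) \<in> borel_measurable (past t)" and "integrable M (\<lambda>z. f z \<bullet> g z)"
proof -
  show *: "(\<lambda>z. f z \<bullet> g z) \<in> borel_measurable (past t)"
    using assms unfolding past_L2_def by (intro borel_measurable_inner) auto
  show "integrable M (\<lambda>z. f z \<bullet> g z)"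
  proof (rule Bochner_Integration.integrable_bound[OF _ past_measurable[OF *]])
    show "integrable M (\<lambda>z. f z \<bullet> f z + g z \<bullet> g z)"
      using assms unfolding past_L2_def by auto
    show "AE z in M. norm (f z \<bullet> g z) \<le> norm (f z \<bullet> f z + g z \<bullet> g z)"
    proof (rule AE_I2)
      fix z
      have "0 \<le> (f z + g z) \<bullet> (f z + g z)" "0 \<le> (f z - g z) \<bullet> (f z - g z)" by simp_all
      moreover have "0 \<le> f z \<bullet> f z" "0 \<le> g z \<bullet> g z" by simp_all
      ultimately show "norm (f z \<bullet> g z) \<le> norm (f z \<bullet> f z + g z \<bullet> g z)"
        by (simp add: inner_add_left inner_add_right inner_diff_left inner_diff_right
            inner_commute[of "g z" "f z"])
    qed
  qed
qed

lemma past_L2_add: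
  assumes "past_L2 t f" "past_L2 t g"
  shows "past_L2 t (\<lambda>z. f z + g z)"
  unfolding past_L2_def
proof
  show "(\<lambda>z. f z + g z) \<in> borel_measurable (past t)"
    using assms unfolding past_L2_def by (intro borel_measurable_add) auto
  show "integrable M (\<lambda>z. (f z + g z) \<bullet> (f z + g z))"
    using past_L2_inner(2)[OF assms(1,1)] past_L2_inner(2)[OF assms(1,2)]
      past_L2_inner(2)[OF assms(2,1)] past_L2_inner(2)[OF assms(2,2)]
    by (simp add: inner_add_left inner_add_right)
qed

lemma past_L2_sum: "(\<And>i. i \<in> I \<Longrightarrow> past_L2 t (f i)) \<Longrightarrow> past_L2 t (\<lambda>z. \<Sum>i\<in>I. f i z)"
  by (induction I rule: infinite_finite_induct) (simp_all add: past_L2_const past_L2_add)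

lemma past_L2_matrix:
  fixes R :: "real^'k^'l"
  assumes "past_L2 t f"
  shows "past_L2 t (\<lambda>z. R *v f z)"
  unfolding past_L2_def
proof
  have R: "(*v) R \<in> borel_measurable borel"
    by (intro borel_measurable_continuous_onI linear_continuous_on matrix_vector_mul_bounded_linear)
  show m: "(\<lambda>z. R *v f z) \<in> borel_measurable (past t)"
    using assms unfolding past_L2_def by (auto intro: measurable_compose[OF _ R])
  obtain c where c: "\<And>v. (R *v v) \<bullet> (R *v v) \<le> c * (v \<bullet> v)"
    using matrix_bounded_quadratic[of R] by blast
  have "integrable M (\<lambda>z. c * (f z \<bullet> f z))"
    using assms unfolding past_L2_def by auto
  then show "integrable M (\<lambda>z. (R *v f z) \<bullet> (R *v f z))"
    by (rule Bochner_Integration.integrable_bound)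
      (use past_measurable[OF m] c in \<open>auto intro!: AE_I2 borel_measurable_inner intro: order_trans[OF c]\<close>)
qed

text \<open>
Without independence the product of two square-integrable variables need not be square-integrable.
\<close>

lemma past_L2_noise:
  assumes f: "past_L2 t f" and \<tau>: "\<tau> \<le> D"
  shows "past_L2 (Suc t) (\<lambda>z. \<omega> \<tau> t z *\<^sub>R f z)"
  unfolding past_L2_def
proof
  show "(\<lambda>z. \<omega> \<tau> t z *\<^sub>R f z) \<in> borel_measurable (past (Suc t))"
    using past_L2_Suc[OF f] \<tau> unfolding past_L2_def
    by (intro borel_measurable_scaleR noise_field_measurable) auto
  show "integrable M (\<lambda>z. (\<omega> \<tau> t z *\<^sub>R f z) \<bullet> (\<omega> \<tau> t z *\<^sub>R f z))"
    using past_times_noise_product(1)[OF past_L2_inner[OF f f] \<tau> \<tau>] by (simp add: mult.assoc)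
qed

lemma past_L2_cong:
  assumes "past_L2 t f" "\<And>z. z \<in> space M \<Longrightarrow> g z = f z"
  shows "past_L2 t g"
proof -
  have "g \<in> borel_measurable (past t) \<longleftrightarrow> f \<in> borel_measurable (past t)"
    using assms(2) by (intro measurable_cong) simp
  moreover have "integrable M (\<lambda>z. g z \<bullet> g z) \<longleftrightarrow> integrable M (\<lambda>z. f z \<bullet> f z)"
    using assms(2) by (intro Bochner_Integration.integrable_cong) auto
  ultimately show ?thesis using assms(1) unfolding past_L2_def by blast
qed

definition mean_form :: "real^'k^'k \<Rightarrow> ('w \<Rightarrow> real^'k) \<Rightarrow> real" where
  "mean_form Q f = expectation (\<lambda>z. f z \<bullet> (Q *v f z))"

lemma past_L2_form: "past_L2 t f \<Longrightarrow> integrable M (\<lambda>z. f z \<bullet> (Q *v f z))"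
  by (intro past_L2_inner(2) past_L2_matrix)

text \<open>
In the expansion, terms linear in the noise vanish since it is centred, and mixed products of
different noise components vanish since these are independent. Only the diagonal survives.
\<close>

lemma mean_form_noise:
  fixes Q :: "real^'k^'k"
  assumes g: "past_L2 t g" and h: "\<And>\<tau>. \<tau> \<le> D \<Longrightarrow> past_L2 t (h \<tau>)"
  shows "mean_form Q (\<lambda>z. g z + (\<Sum>\<tau>\<le>D. \<omega> \<tau> t z *\<^sub>R h \<tau> z)) =
    mean_form Q g + (\<Sum>\<tau>\<le>D. (\<sigma> \<tau>)\<^sup>2 * mean_form Q (h \<tau>))"
proof -
  have expand: "(g z + (\<Sum>\<tau>\<le>D. \<omega> \<tau> t z *\<^sub>R h \<tau> z)) \<bullet> (Q *v (g z + (\<Sum>\<tau>\<le>D. \<omega> \<tau> t z *\<^sub>R h \<tau> z))) =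
      g z \<bullet> (Q *v g z) + (\<Sum>\<tau>\<le>D. \<omega> \<tau> t z * (h \<tau> z \<bullet> (Q *v g z) + g z \<bullet> (Q *v h \<tau> z)))
      + (\<Sum>\<tau>\<le>D. \<Sum>\<rho>\<le>D. \<omega> \<tau> t z * \<omega> \<rho> t z * (h \<tau> z \<bullet> (Q *v h \<rho> z)))" for z
    by (simp add: matvec_simps inner_add_left inner_add_right inner_sum_left inner_sum_right
        sum.distrib algebra_simps sum_distrib_left)
      (subst sum.swap, simp add: mult.left_commute)
  have L: "past_L2 t (\<lambda>z. Q *v g z)" "\<And>\<tau>. \<tau> \<le> D \<Longrightarrow> past_L2 t (\<lambda>z. Q *v h \<tau> z)"
    using g h by (auto intro: past_L2_matrix)
  have cross: "(\<lambda>z. h \<tau> z \<bullet> (Q *v g z) + g z \<bullet> (Q *v h \<tau> z)) \<in> borel_measurable (past t)"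
      "integrable M (\<lambda>z. h \<tau> z \<bullet> (Q *v g z) + g z \<bullet> (Q *v h \<tau> z))" if "\<tau> \<le> D" for \<tau>
    using past_L2_inner[OF h L(1)] past_L2_inner[OF g L(2)] that by auto
  note c1 = past_times_noise[OF cross]
  have pair: "(\<lambda>z. h \<tau> z \<bullet> (Q *v h \<rho> z)) \<in> borel_measurable (past t)"
      "integrable M (\<lambda>z. h \<tau> z \<bullet> (Q *v h \<rho> z))" if "\<tau> \<le> D" "\<rho> \<le> D" for \<tau> \<rho>
    using past_L2_inner[OF h L(2)] that by auto
  note c2 = past_times_noise_product[OF pair]
  let ?a = "\<lambda>\<tau> z. \<omega> \<tau> t z * (h \<tau> z \<bullet> (Q *v g z) + g z \<bullet> (Q *v h \<tau> z))"
  let ?b = "\<lambda>\<tau> \<rho> z. \<omega> \<tau> t z * \<omega> \<rho> t z * (h \<tau> z \<bullet> (Q *v h \<rho> z))"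
  have int: "integrable M (\<lambda>z. \<Sum>\<tau>\<le>D. ?a \<tau> z)" "integrable M (\<lambda>z. \<Sum>\<tau>\<le>D. \<Sum>\<rho>\<le>D. ?b \<tau> \<rho> z)"
    using c1(1) c2(1) by (auto intro!: Bochner_Integration.integrable_sum)
  have "expectation (\<lambda>z. \<Sum>\<tau>\<le>D. ?a \<tau> z) = (\<Sum>\<tau>\<le>D. expectation (?a \<tau>))"
    using c1(1) by (intro Bochner_Integration.integral_sum) auto
  also have "\<dots> = 0" using c1(2) by (intro sum.neutral) auto
  finally have a: "expectation (\<lambda>z. \<Sum>\<tau>\<le>D. ?a \<tau> z) = 0" .
  have "expectation (\<lambda>z. \<Sum>\<tau>\<le>D. \<Sum>\<rho>\<le>D. ?b \<tau> \<rho> z)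
      = (\<Sum>\<tau>\<le>D. expectation (\<lambda>z. \<Sum>\<rho>\<le>D. ?b \<tau> \<rho> z))"
    using c2(1) by (intro Bochner_Integration.integral_sum Bochner_Integration.integrable_sum) auto
  also have "\<dots> = (\<Sum>\<tau>\<le>D. \<Sum>\<rho>\<le>D. expectation (?b \<tau> \<rho>))"
    using c2(1) by (intro sum.cong refl Bochner_Integration.integral_sum) auto
  also have "\<dots> = (\<Sum>\<tau>\<le>D. \<Sum>\<rho>\<le>D. if \<tau> = \<rho> then (\<sigma> \<tau>)\<^sup>2 * mean_form Q (h \<tau>) else 0)"
    using c2(2) by (intro sum.cong refl) (auto simp: mean_form_def)
  also have "\<dots> = (\<Sum>\<tau>\<le>D. (\<sigma> \<tau>)\<^sup>2 * mean_form Q (h \<tau>))"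
    by (intro sum.cong refl) simp
  finally have b: "expectation (\<lambda>z. \<Sum>\<tau>\<le>D. \<Sum>\<rho>\<le>D. ?b \<tau> \<rho> z)
      = (\<Sum>\<tau>\<le>D. (\<sigma> \<tau>)\<^sup>2 * mean_form Q (h \<tau>))" .
  show ?thesis
    unfolding mean_form_def[of Q "\<lambda>z. g z + _ z"] expand
    using int past_L2_form[OF g, of Q]
    by (simp add: a b Bochner_Integration.integral_add mean_form_def[of Q g])
qed

end

section \<open>Mean squares of closed-loop trajectories\<close>

text \<open>
Shifting a window of summation by \<open>\<tau>\<close> exchanges \<open>\<tau>\<close> terms at its end for \<open>\<tau>\<close> terms before its start.
For nonnegative \<open>c\<close> the terms before the start bound the increase and those at the end the decrease;
sufficiency uses the former and necessity the latter.
\<close>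

lemma sum_shifted:
  fixes c :: "int \<Rightarrow> real"
  shows "(\<Sum>t<N. c (int t - int \<tau>)) =
    (\<Sum>t<N. c (int t)) + (\<Sum>j<\<tau>. c (- 1 - int j)) - (\<Sum>j<\<tau>. c (int N - 1 - int j))"
proof (induction \<tau>)
  case (Suc \<tau>)
  have "(\<Sum>t<N. c (int t - int \<tau>) - c (int t - int (Suc \<tau>))) = c (int N - 1 - int \<tau>) - c (- 1 - int \<tau>)"
    by (induction N) (simp_all add: algebra_simps)
  then show ?case using Suc by (simp add: sum_subtractf)
qed simp

context delayed_noise
begin

abbreviation mean_square :: "('w \<Rightarrow> real^'k) \<Rightarrow> real" where
  "mean_square \<equiv> mean_form (mat 1)"

lemma mean_square_eq: "mean_square f = expectation (\<lambda>z. f z \<bullet> f z)"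
  by (simp add: mean_form_def)

lemma mean_form_nonneg: "pos_semidef Q \<Longrightarrow> 0 \<le> mean_form Q f"
  unfolding mean_form_def pos_semidef_def by (intro Bochner_Integration.integral_nonneg) simp

lemma pos_semidef_mat1: "pos_semidef (mat 1)"
  by (simp add: pos_semidef_def)

lemma mean_form_le_trace:
  assumes "pos_semidef Q" "past_L2 t f"
  shows "mean_form Q f \<le> trace Q * mean_square f"
proof -
  have "mean_form Q f \<le> expectation (\<lambda>z. trace Q * (f z \<bullet> f z))"
    unfolding mean_form_def using assms past_L2_form[OF assms(2)]
    by (intro integral_mono pos_semidef_le_trace) (auto simp: past_L2_def)
  then show ?thesis by (simp add: mean_square_eq)
qed

lemma mean_form_cong: "(\<And>z. z \<in> space M \<Longrightarrow> f z = g z) \<Longrightarrow> mean_form Q f = mean_form Q g"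
  unfolding mean_form_def by (intro Bochner_Integration.integral_cong) auto

lemma mean_form_const: "(\<And>z. z \<in> space M \<Longrightarrow> f z = v) \<Longrightarrow> mean_form Q f = v \<bullet> (Q *v v)"
  using mean_form_cong[of f "\<lambda>_. v"] by (simp add: mean_form_def prob_space)

lemma mean_form_scaleR_matrix:
  "mean_form Q (\<lambda>z. (c *\<^sub>R R) *v f z) = c\<^sup>2 * mean_form Q (\<lambda>z. R *v f z)"
  by (simp add: mean_form_def matvec_simps power2_eq_square mult.assoc)

lemma mean_form_lyap:
  fixes F :: "real^'k^'k"
  assumes "past_L2 t f"
  shows "mean_form (lyap D F G Q) f =
    mean_form Q (\<lambda>z. F *v f z) + (\<Sum>\<tau>\<le>D. mean_form Q (\<lambda>z. G \<tau> *v f z))"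
proof -
  have "integrable M (\<lambda>z. (R *v f z) \<bullet> (Q *v (R *v f z)))" for R :: "real^'k^'k"
    by (rule past_L2_form[OF past_L2_matrix[OF assms]])
  then show ?thesis unfolding mean_form_def lyap_quadratic by simp
qed

lemma mean_square_matrix_le:
  fixes R :: "real^'k^'l"
  obtains c where "\<And>t f. past_L2 t f \<Longrightarrow> mean_square (\<lambda>z. R *v f z) \<le> c * mean_square f"
proof -
  obtain c where c: "\<And>v. (R *v v) \<bullet> (R *v v) \<le> c * (v \<bullet> v)"
    using matrix_bounded_quadratic[of R] by blast
  have "mean_square (\<lambda>z. R *v f z) \<le> c * mean_square f" if f: "past_L2 t f" for t f
  proof -
    have "mean_square (\<lambda>z. R *v f z) \<le> expectation (\<lambda>z. c * (f z \<bullet> f z))"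
      unfolding mean_square_eq using f past_L2_matrix[OF f, of R] c
      by (intro integral_mono) (auto simp: past_L2_def)
    then show ?thesis by (simp add: mean_square_eq)
  qed
  then show thesis by (rule that)
qed

text \<open>
Convergence to zero in mean square. Square-integrability is included because the integral of a
non-integrable function is zero by convention, which would break closure under sums.
\<close>

definition vanishing :: "(nat \<Rightarrow> 'w \<Rightarrow> real^'k) \<Rightarrow> bool" where
  "vanishing f \<longleftrightarrow> (\<forall>t. past_L2 t (f t)) \<and> (\<lambda>t. mean_square (f t)) \<longlonglongrightarrow> 0"

lemma vanishingI:
  assumes "\<And>t. past_L2 t (f t)" "\<And>t. mean_square (f t) \<le> b t" "b \<longlonglongrightarrow> 0"
  shows "vanishing f"
  unfolding vanishing_def
proof
  show "(\<lambda>t. mean_square (f t)) \<longlonglongrightarrow> 0"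
    by (rule tendsto_sandwich[OF _ _ tendsto_const assms(3)])
      (simp_all add: assms(2) mean_form_nonneg[OF pos_semidef_mat1])
qed (simp add: assms(1))

lemma vanishing_matrix:
  fixes R :: "real^'k^'l"
  assumes "vanishing f"
  shows "vanishing (\<lambda>t z. R *v f t z)"
proof -
  obtain c where c: "\<And>t f. past_L2 t f \<Longrightarrow> mean_square (\<lambda>z. R *v f z) \<le> c * mean_square f"
    by (rule mean_square_matrix_le[of R]) (rule that)
  show ?thesis
  proof (rule vanishingI[where b="\<lambda>t. c * mean_square (f t)"])
    show "(\<lambda>t. c * mean_square (f t)) \<longlonglongrightarrow> 0"
      using assms unfolding vanishing_def by (auto intro: tendsto_mult_right_zero)
  qed (use assms c in \<open>auto simp: vanishing_def intro: past_L2_matrix\<close>)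
qed

lemma vanishing_add:
  assumes "vanishing f" "vanishing g"
  shows "vanishing (\<lambda>t z. f t z + g t z)"
proof (rule vanishingI[where b="\<lambda>t. 2 * mean_square (f t) + 2 * mean_square (g t)"])
  have L: "past_L2 t (f t)" "past_L2 t (g t)" for t
    using assms unfolding vanishing_def by auto
  show "past_L2 t (\<lambda>z. f t z + g t z)" for t by (intro past_L2_add L)
  show "mean_square (\<lambda>z. f t z + g t z) \<le> 2 * mean_square (f t) + 2 * mean_square (g t)" for t
  proof -
    have "(v + w) \<bullet> (v + w) \<le> 2 * (v \<bullet> v) + 2 * (w \<bullet> w)" for v w :: "real^'a"
      using inner_ge_zero[of "v - w"]
      by (simp add: inner_add_left inner_add_right inner_diff_left inner_diff_right inner_commute)
    then have "mean_square (\<lambda>z. f t z + g t z) \<le>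
        expectation (\<lambda>z. 2 * (f t z \<bullet> f t z) + 2 * (g t z \<bullet> g t z))"
      unfolding mean_square_eq using L[of t] past_L2_add[OF L, of t]
      by (intro integral_mono) (auto simp: past_L2_def)
    also have "\<dots> = 2 * mean_square (f t) + 2 * mean_square (g t)"
      unfolding mean_square_eq using L[of t] by (simp add: past_L2_def)
    finally show ?thesis .
  qed
  show "(\<lambda>t. 2 * mean_square (f t) + 2 * mean_square (g t)) \<longlonglongrightarrow> 0"
    using assms unfolding vanishing_def by (intro tendsto_add_zero tendsto_mult_right_zero) auto
qed

lemma vanishing_sum:
  "(\<And>i. i \<in> I \<Longrightarrow> vanishing (f i)) \<Longrightarrow> vanishing (\<lambda>t z. \<Sum>i\<in>I. f i t z)"
proof (induction I rule: infinite_finite_induct)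
  case (insert i I)
  then show ?case by (simp add: vanishing_add)
qed (simp_all add: vanishing_def past_L2_const mean_square_eq)

text \<open>
Under a linear feedback the input is a function of the present state and earlier inputs, so by
induction states and inputs are square-integrable functions of the strictly earlier noise.
\<close>

lemma closed_loop_past_L2:
  fixes A :: "real^'n^'n" and B C :: "nat \<Rightarrow> real^'m^'n"
  assumes fb: "feedback_law M D K0 K (state D A B C \<omega> x0 u) u"
    and init: "\<And>s z. - int D \<le> s \<Longrightarrow> s < 0 \<Longrightarrow> z \<in> space M \<Longrightarrow> u s z = u0 s"
  shows "past_L2 t (state D A B C \<omega> x0 u t)"
    and "- int D \<le> s \<Longrightarrow> s \<le> int t \<Longrightarrow> past_L2 t (u s)"
proof -
  let ?x = "state D A B C \<omega> x0 u"
  have input: "past_L2 t (u (int t))"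
    if x: "past_L2 t (?x t)" and u: "\<And>s. - int D \<le> s \<Longrightarrow> s < int t \<Longrightarrow> past_L2 t (u s)" for t
  proof (rule past_L2_cong)
    show "past_L2 t (\<lambda>z. K0 *v ?x t z + (\<Sum>\<tau>=1..D. K \<tau> *v u (int t - int \<tau>) z))"
      by (intro past_L2_add past_L2_sum past_L2_matrix x u) auto
    show "u (int t) z = K0 *v ?x t z + (\<Sum>\<tau>=1..D. K \<tau> *v u (int t - int \<tau>) z)"
      if "z \<in> space M" for z
      using fb that unfolding feedback_law_def by blast
  qed
  have main: "past_L2 t (?x t) \<and> (\<forall>s. - int D \<le> s \<and> s < int t \<longrightarrow> past_L2 t (u s))" for t
  proof (induction t)
    case 0
    have "?x 0 = (\<lambda>_. x0)" by (simp add: fun_eq_iff)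
    then show ?case
      using init by (auto intro: past_L2_const past_L2_cong[OF past_L2_const])
  next
    case (Suc t)
    have u: "past_L2 t (u s)" if "- int D \<le> s" "s \<le> int t" for s
      using Suc input[of t] that by (cases "s = int t") auto
    have "past_L2 (Suc t) (\<lambda>z. A *v ?x t z +
        (\<Sum>\<tau>\<le>D. B \<tau> *v u (int t - int \<tau>) z + \<omega> \<tau> t z *\<^sub>R (C \<tau> *v u (int t - int \<tau>) z)))"
      using Suc by (intro past_L2_add past_L2_sum past_L2_noise past_L2_Suc[OF past_L2_matrix]
          past_L2_matrix u) auto
    moreover have "?x (Suc t) = (\<lambda>z. A *v ?x t z +
        (\<Sum>\<tau>\<le>D. B \<tau> *v u (int t - int \<tau>) z + \<omega> \<tau> t z *\<^sub>R (C \<tau> *v u (int t - int \<tau>) z)))"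
      by (simp add: fun_eq_iff matvec_simps)
    moreover have "past_L2 (Suc t) (u s)" if "- int D \<le> s" "s < int (Suc t)" for s
      using that by (intro past_L2_Suc u) auto
    ultimately show ?case by simp
  qed
  show "past_L2 t (?x t)" using main by blast
  show "- int D \<le> s \<Longrightarrow> s \<le> int t \<Longrightarrow> past_L2 t (u s)"
    using main input[of t] by (cases "s = int t") auto
qed

lemma predictor_past_L2:
  assumes "\<And>t. past_L2 t (x t)" "\<And>t s. - int D \<le> s \<Longrightarrow> s \<le> int t \<Longrightarrow> past_L2 t (u s)"
  shows "past_L2 t (predictor D A B x u t)"
proof -
  have "past_L2 t (\<lambda>z. matpow A D *v x t z + (\<Sum>j=1..D. predictor_gain D A B j *v u (int t - int j) z))"
    by (intro past_L2_add past_L2_sum past_L2_matrix assms) auto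
  then show ?thesis by (simp add: predictor_def[abs_def])
qed

lemma predictor_moment_step:
  fixes A :: "real^'n^'n" and B C :: "nat \<Rightarrow> real^'m^'n"
  assumes x_def: "x = state D A B C \<omega> x0 u" and y_def: "y = predictor D A B x u"
    and x: "\<And>t. past_L2 t (x t)"
    and u: "\<And>t s. - int D \<le> s \<Longrightarrow> s \<le> int t \<Longrightarrow> past_L2 t (u s)"
  shows "mean_form Q (y (Suc t)) =
    mean_form Q (\<lambda>z. A *v y t z + Lmat D A B *v u (int t) z) +
    (\<Sum>\<tau>\<le>D. mean_form Q (\<lambda>z. (\<sigma> \<tau> *\<^sub>R (matpow A D ** C \<tau>)) *v u (int t - int \<tau>) z))"
proof -
  have y: "past_L2 t (y t)"
    unfolding y_def by (rule predictor_past_L2[OF x u])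
  have "mean_form Q (y (Suc t)) = mean_form Q (\<lambda>z. (A *v y t z + Lmat D A B *v u (int t) z) +
    (\<Sum>\<tau>\<le>D. \<omega> \<tau> t z *\<^sub>R ((matpow A D ** C \<tau>) *v u (int t - int \<tau>) z)))"
    unfolding y_def x_def by (rule mean_form_cong, rule predictor_step)
  also have "\<dots> = mean_form Q (\<lambda>z. A *v y t z + Lmat D A B *v u (int t) z) +
    (\<Sum>\<tau>\<le>D. (\<sigma> \<tau>)\<^sup>2 * mean_form Q (\<lambda>z. (matpow A D ** C \<tau>) *v u (int t - int \<tau>) z))"
    using y by (intro mean_form_noise past_L2_add past_L2_matrix u) auto
  finally show ?thesis unfolding mean_form_scaleR_matrix .
qed

end

section \<open>Sufficiency\<close>

lemma state_cong:
  "(\<And>s. s < int t \<Longrightarrow> u s z = u' s z) \<Longrightarrow> state D A B C \<omega> x0 u t z = state D A B C \<omega> x0 u' t z"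
  by (induction t) simp_all

text \<open>
The input process after \<open>t\<close> steps of the closed loop: input and state depend on each other, which is
resolved by adding one input at a time to a process that starts with the initial data. The entries
at times \<open>t\<close> and later are placeholders.
\<close>

primrec feedback_inputs ::
  "nat \<Rightarrow> real^'n^'n \<Rightarrow> (nat \<Rightarrow> real^'m^'n) \<Rightarrow> (nat \<Rightarrow> real^'m^'n)
    \<Rightarrow> (nat \<Rightarrow> nat \<Rightarrow> 'w \<Rightarrow> real) \<Rightarrow> real^'n \<Rightarrow> (int \<Rightarrow> real^'m)
    \<Rightarrow> real^'n^'m \<Rightarrow> (nat \<Rightarrow> real^'m^'m) \<Rightarrow> nat \<Rightarrow> int \<Rightarrow> 'w \<Rightarrow> real^'m" where
  "feedback_inputs D A B C \<omega> x0 u0 K0 K 0 = (\<lambda>s z. u0 s)"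
| "feedback_inputs D A B C \<omega> x0 u0 K0 K (Suc t) =
     (let u = feedback_inputs D A B C \<omega> x0 u0 K0 K t
      in u(int t := \<lambda>z. K0 *v state D A B C \<omega> x0 u t z + (\<Sum>\<tau>=1..D. K \<tau> *v u (int t - int \<tau>) z)))"

text \<open>
The input of time \<open>s\<close> is read off as soon as it has been added, and the state at time \<open>t\<close> only depends
on inputs before \<open>t\<close>.
\<close>

lemma closed_loop_exists:
  fixes A :: "real^'n^'n" and B C :: "nat \<Rightarrow> real^'m^'n"
  obtains u where "\<And>s z. s < 0 \<Longrightarrow> u s z = u0 s"
    and "\<And>t z. u (int t) z =
      K0 *v state D A B C \<omega> x0 u t z + (\<Sum>\<tau>=1..D. K \<tau> *v u (int t - int \<tau>) z)"
proof -
  let ?v = "feedback_inputs D A B C \<omega> x0 u0 K0 K"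
  define u where "u s = ?v (nat (s + 1)) s" for s
  have agree: "?v t s = u s" if "s < int t" for s t
    using that
  proof (induction t)
    case 0
    then show ?case by (simp add: u_def)
  next
    case (Suc t)
    show ?case
    proof (cases "s = int t")
      case True
      have "nat (1 + int t) = Suc t" by simp
      then show ?thesis by (simp add: u_def True add.commute del: feedback_inputs.simps)
    qed (use Suc in \<open>simp add: Let_def\<close>)
  qed
  show thesis
  proof
    show "u s z = u0 s" if "s < 0" for s z using that by (simp add: u_def)
    show "u (int t) z = K0 *v state D A B C \<omega> x0 u t z + (\<Sum>\<tau>=1..D. K \<tau> *v u (int t - int \<tau>) z)" for t z
    proof -
      have "u (int t) z = K0 *v state D A B C \<omega> x0 (?v t) t z + (\<Sum>\<tau>=1..D. K \<tau> *v ?v t (int t - int \<tau>) z)"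
        using agree[of "int t" "Suc t"] by (simp add: Let_def fun_upd_def fun_eq_iff)
      also have "state D A B C \<omega> x0 (?v t) t z = state D A B C \<omega> x0 u t z"
        by (rule state_cong) (simp add: agree)
      also have "(\<Sum>\<tau>=1..D. K \<tau> *v ?v t (int t - int \<tau>) z) = (\<Sum>\<tau>=1..D. K \<tau> *v u (int t - int \<tau>) z)"
        by (intro sum.cong refl) (simp add: agree)
      finally show ?thesis .
    qed
  qed
qed

context delayed_noise
begin

text \<open>
A Lyapunov argument: \<open>E y\<^sub>t\<bullet>Py\<^sub>t\<close> drops in each step by at least a multiple of \<open>E|y\<^sub>t|\<^sup>2\<close>, except that
the noise terms \<open>c\<close> appear with their delayed instead of their present inputs. In the sum over time
this exchange costs at most the finitely many terms of the initial inputs.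
\<close>

lemma summable_if_lyap_feasible:
  fixes F :: "real^'n^'n" and R :: "nat \<Rightarrow> real^'m^'n" and K :: "real^'n^'m"
  assumes P: "pos_def P" and feas: "lyap_feasible D F (\<lambda>\<tau>. R \<tau> ** K) P"
    and y: "\<And>t. past_L2 t (y t)"
    and u: "\<And>t z. z \<in> space M \<Longrightarrow> u (int t) z = K *v y t z"
    and step: "\<And>t. mean_form P (y (Suc t)) =
      mean_form P (\<lambda>z. F *v y t z) + (\<Sum>\<tau>\<le>D. mean_form P (\<lambda>z. R \<tau> *v u (int t - int \<tau>) z))"
  shows "summable (\<lambda>t. mean_square (y t))"
proof -
  let ?L = "lyap D F (\<lambda>\<tau>. R \<tau> ** K) P"
  let ?V = "\<lambda>t. mean_form P (y t)"
  define c where "c \<tau> s = mean_form P (\<lambda>z. R \<tau> *v u s z)" for \<tau> s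
  note psd = pos_def_imp_pos_semidef[OF P]
  have c_nonneg: "0 \<le> c \<tau> s" for \<tau> s unfolding c_def by (rule mean_form_nonneg[OF psd])
  have "0 < v \<bullet> ((P - ?L) *v v)" if "v \<noteq> 0" for v
    using feas that by (simp add: lyap_feasible_def matrix_vector_mult_diff_rdistrib inner_diff_right)
  then obtain e where e: "e > 0" "\<And>v. e * (v \<bullet> v) \<le> v \<bullet> ((P - ?L) *v v)"
    using pos_def_coercive[of "P - ?L"] by blast
  have decrease: "e * mean_square (y t) \<le> ?V t - ?V (Suc t) + (\<Sum>\<tau>\<le>D. c \<tau> (int t - int \<tau>) - c \<tau> (int t))" for t
  proof -
    have "e * mean_square (y t) = expectation (\<lambda>z. e * (y t z \<bullet> y t z))"
      by (simp add: mean_square_eq)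
    also have "\<dots> \<le> expectation (\<lambda>z. y t z \<bullet> (P *v y t z) - y t z \<bullet> (?L *v y t z))"
      using e(2) past_L2_form[OF y[of t]] y[of t]
      by (intro integral_mono) (auto simp: past_L2_def matrix_vector_mult_diff_rdistrib inner_diff_right)
    also have "\<dots> = ?V t - mean_form ?L (y t)"
      using past_L2_form[OF y[of t]] by (simp add: mean_form_def)
    also have "mean_form ?L (y t) = mean_form P (\<lambda>z. F *v y t z) + (\<Sum>\<tau>\<le>D. mean_form P (\<lambda>z. (R \<tau> ** K) *v y t z))"
      by (rule mean_form_lyap[OF y])
    also have "(\<Sum>\<tau>\<le>D. mean_form P (\<lambda>z. (R \<tau> ** K) *v y t z)) = (\<Sum>\<tau>\<le>D. c \<tau> (int t))"
      unfolding c_def by (intro sum.cong refl mean_form_cong) (simp add: u matrix_vector_mul_assoc)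
    finally show ?thesis using step[of t] by (simp add: c_def sum_subtractf)
  qed
  show ?thesis
  proof (rule summableI_nonneg_bounded)
    show "0 \<le> mean_square (y t)" for t by (rule mean_form_nonneg[OF pos_semidef_mat1])
    show "(\<Sum>t<N. mean_square (y t)) \<le> (?V 0 + (\<Sum>\<tau>\<le>D. \<Sum>j<\<tau>. c \<tau> (- 1 - int j))) / e" for N
    proof -
      have "e * (\<Sum>t<N. mean_square (y t)) \<le>
          (\<Sum>t<N. ?V t - ?V (Suc t) + (\<Sum>\<tau>\<le>D. c \<tau> (int t - int \<tau>) - c \<tau> (int t)))"
        unfolding sum_distrib_left by (intro sum_mono decrease)
      also have "\<dots> = ?V 0 - ?V N + (\<Sum>\<tau>\<le>D. (\<Sum>t<N. c \<tau> (int t - int \<tau>)) - (\<Sum>t<N. c \<tau> (int t)))"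
        unfolding sum.distrib sum_lessThan_telescope'[of ?V] sum.swap[of _ "{..D}" "{..<N}"] by (simp only: sum_subtractf)
      also have "\<dots> \<le> ?V 0 + (\<Sum>\<tau>\<le>D. \<Sum>j<\<tau>. c \<tau> (- 1 - int j))"
      proof -
        have "(\<Sum>\<tau>\<le>D. (\<Sum>t<N. c \<tau> (int t - int \<tau>)) - (\<Sum>t<N. c \<tau> (int t))) \<le> (\<Sum>\<tau>\<le>D. \<Sum>j<\<tau>. c \<tau> (- 1 - int j))"
          unfolding sum_shifted using c_nonneg by (intro sum_mono) (auto intro!: sum_nonneg)
        moreover have "0 \<le> ?V N" by (rule mean_form_nonneg[OF psd])
        ultimately show ?thesis by linarith
      qed
      finally show ?thesis using e(1) by (simp add: pos_le_divide_eq mult.commute)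
    qed
  qed
qed

lemma vanishing_inputs_shift:
  assumes u: "\<And>t s. - int D \<le> s \<Longrightarrow> s \<le> int t \<Longrightarrow> past_L2 t (u s)"
    and lim: "(\<lambda>t. mean_square (u (int t))) \<longlonglongrightarrow> 0" and j: "j \<le> D"
  shows "vanishing (\<lambda>t. u (int t - int j))"
  unfolding vanishing_def
proof
  show "\<forall>t. past_L2 t (u (int t - int j))" using u j by auto
  show "(\<lambda>t. mean_square (u (int t - int j))) \<longlonglongrightarrow> 0"
    by (rule LIMSEQ_offset[of _ j]) (use lim in simp)
qed

text \<open>
The gains expand \<open>u\<^sub>t = K y\<^sub>t\<close> in terms of the state and the past inputs. The state is recovered from
the predictor and the inputs by \<open>A\<^sup>-\<^sup>D\<close>, so it inherits their decay.
\<close>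

theorem stabilizable_if_lyap_feasible:
  fixes A :: "real^'n^'n" and B C :: "nat \<Rightarrow> real^'m^'n" and K :: "real^'n^'m"
  assumes A: "invertible A" and P: "pos_def P"
    and feas: "lyap_feasible D (A + Lmat D A B ** K) (\<lambda>\<tau>. \<sigma> \<tau> *\<^sub>R (matpow A D ** C \<tau> ** K)) P"
  shows "ms_stabilizable M D A B C \<omega>"
proof -
  define K0 where "K0 = K ** matpow A D"
  define G where "G = predictor_gain D A B"
  have "\<exists>u \<in> U_ad M D A B C \<omega> x0 u0.
      let x = state D A B C \<omega> x0 u in
        feedback_law M D K0 (\<lambda>j. K ** G j) x u \<and>
        (\<forall>t. integrable M (\<lambda>z. x t z \<bullet> x t z)) \<and> (\<lambda>t. expectation (\<lambda>z. x t z \<bullet> x t z)) \<longlonglongrightarrow> 0" for x0 u0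
  proof -
    obtain u where init: "\<And>s z. s < 0 \<Longrightarrow> u s z = u0 s"
      and law: "\<And>t z. u (int t) z = K0 *v state D A B C \<omega> x0 u t z
        + (\<Sum>\<tau>=1..D. (K ** G \<tau>) *v u (int t - int \<tau>) z)"
      using closed_loop_exists[of u0 K0 D A B C \<omega> x0 "\<lambda>j. K ** G j"] by blast
    define x where "x = state D A B C \<omega> x0 u"
    define y where "y = predictor D A B x u"
    have fb: "feedback_law M D K0 (\<lambda>j. K ** G j) x u"
      unfolding feedback_law_def x_def using law by blast
    have x: "past_L2 t (x t)" for t
      unfolding x_def by (rule closed_loop_past_L2(1)[OF fb[unfolded x_def]]) (rule init)
    have u: "past_L2 t (u s)" if "- int D \<le> s" "s \<le> int t" for s t
      by (rule closed_loop_past_L2(2)[OF fb[unfolded x_def] _ that]) (rule init)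
    have y: "past_L2 t (y t)" for t unfolding y_def by (rule predictor_past_L2[OF x u])
    have uy: "u (int t) z = K *v y t z" for t z
      unfolding law y_def predictor_def x_def K0_def G_def by (simp add: matvec_simps)
    have feas': "lyap_feasible D (A + Lmat D A B ** K) (\<lambda>\<tau>. (\<sigma> \<tau> *\<^sub>R (matpow A D ** C \<tau>)) ** K) P"
      using feas by (simp add: lyap_feasible_def lyap_quadratic matvec_simps)
    have sum_y: "summable (\<lambda>t. mean_square (y t))"
    proof (rule summable_if_lyap_feasible[OF P feas' y uy])
      show "mean_form P (y (Suc t)) = mean_form P (\<lambda>z. (A + Lmat D A B ** K) *v y t z) +
         (\<Sum>\<tau>\<le>D. mean_form P (\<lambda>z. (\<sigma> \<tau> *\<^sub>R (matpow A D ** C \<tau>)) *v u (int t - int \<tau>) z))" for t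
        using predictor_moment_step[OF x_def y_def x u, where Q=P and t=t]
        by (simp add: uy matvec_simps)
    qed
    obtain k where k: "\<And>t f. past_L2 t f \<Longrightarrow> mean_square (\<lambda>z. K *v f z) \<le> k * mean_square f"
      by (rule mean_square_matrix_le[of K]) (rule that)
    have sum_u: "summable (\<lambda>t. mean_square (u (int t)))"
    proof (rule summable_comparison_test')
      show "summable (\<lambda>t. k * mean_square (y t))" by (rule summable_mult[OF sum_y])
      show "norm (mean_square (u (int t))) \<le> k * mean_square (y t)" for t
        using k[OF y[of t]] mean_form_nonneg[OF pos_semidef_mat1, of "u (int t)"]
        by (simp add: uy[abs_def])
    qed
    have van_y: "vanishing y" using y summable_LIMSEQ_zero[OF sum_y] by (simp add: vanishing_def)
    note van_u = vanishing_inputs_shift[OF u summable_LIMSEQ_zero[OF sum_u]]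
    let ?I = "matrix_inv (matpow A D)"
    have x_eq: "x t z = ?I *v (y t z + (\<Sum>j=1..D. (- G j) *v u (int t - int j) z))" for t z
    proof -
      have "y t z + (\<Sum>j=1..D. (- G j) *v u (int t - int j) z) = matpow A D *v x t z"
        unfolding y_def predictor_def G_def by (simp add: matrix_vector_uminus sum_negf)
      then show ?thesis
        by (simp add: matrix_vector_mul_assoc matrix_inv_cancel[OF invertible_matpow[OF A]])
    qed
    have "vanishing x"
      unfolding x_eq[abs_def]
      by (intro vanishing_matrix vanishing_add vanishing_sum van_y van_u) auto
    then have lim_x: "(\<lambda>t. expectation (\<lambda>z. x t z \<bullet> x t z)) \<longlonglongrightarrow> 0"
      by (simp add: vanishing_def mean_square_eq)
    have meas: "u (int t) \<in> borel_measurable (noise_sigma M D \<omega> t)" for t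
      unfolding noise_sigma_eq using u[of "int t" t]
      by (auto simp: past_L2_def intro: noise_field_mono[rotated])
    have "integrable M (\<lambda>z. u (int t) z \<bullet> u (int t) z)" for t
      using u[of "int t" t] by (simp add: past_L2_def)
    then have "u \<in> U_ad M D A B C \<omega> x0 u0"
      unfolding U_ad_def using init meas sum_u fb
      by (auto simp: mean_square_eq x_def)
    moreover have "\<forall>t. integrable M (\<lambda>z. x t z \<bullet> x t z)"
      using x by (auto simp: past_L2_def)
    ultimately show ?thesis
      using fb lim_x by (auto simp: x_def Let_def intro!: bexI[of _ u])
  qed
  then show ?thesis unfolding ms_stabilizable_def by blast
qed

section \<open>Necessity\<close>

lemma past_L2_components:
  fixes f :: "'w \<Rightarrow> real^'n" and g :: "'w \<Rightarrow> real^'m"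
  assumes "past_L2 t f" "past_L2 t g"
  shows "integrable M (\<lambda>z. f z $ a * g z $ b)"
proof -
  let ?E = "\<chi> i j. if i = a then if j = b then 1 else 0 else 0 :: real^'m^'n"
  have E: "?E *v w = w $ b *\<^sub>R axis a 1" for w
    by (auto simp: vec_eq_iff matrix_vector_mult_def axis_def mult_delta_left)
  then show ?thesis
    using past_L2_inner(2)[OF assms(1) past_L2_matrix[OF assms(2), of ?E]]
    by (simp add: E inner_axis mult.commute)
qed

text \<open>
The solution of the normal equations \<open>K \<Xi> = \<Gamma>\<close> for the Gram matrices \<open>\<Xi>\<close> of \<open>f\<close> and \<open>\<Gamma>\<close> of \<open>g\<close>
against \<open>f\<close>. Orthogonality of the residual to \<open>f\<close> is stated for all bilinear pairings \<open>W\<close> because this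
is the shape in which the cross terms of quadratic forms appear.
\<close>

lemma least_squares_gain:
  fixes f :: "'i \<Rightarrow> 'w \<Rightarrow> real^'n" and g :: "'i \<Rightarrow> 'w \<Rightarrow> real^'m"
  assumes f: "\<And>i. i \<in> T \<Longrightarrow> past_L2 t (f i)" and g: "\<And>i. i \<in> T \<Longrightarrow> past_L2 t (g i)"
    and pos: "\<And>v. v \<noteq> 0 \<Longrightarrow> 0 < (\<Sum>i\<in>T. expectation (\<lambda>z. (v \<bullet> f i z)\<^sup>2))"
  obtains K :: "real^'n^'m"
  where "\<And>W. (\<Sum>i\<in>T. expectation (\<lambda>z. f i z \<bullet> (W *v (g i z - K *v f i z)))) = 0"
proof -
  define \<Xi> :: "real^'n^'n" where "\<Xi> = (\<chi> a c. \<Sum>i\<in>T. expectation (\<lambda>z. f i z $ a * f i z $ c))"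
  define \<Gamma> :: "real^'n^'m" where "\<Gamma> = (\<chi> b a. \<Sum>i\<in>T. expectation (\<lambda>z. f i z $ a * g i z $ b))"
  note ff = past_L2_components[OF f f] and fg = past_L2_components[OF f g]
  have "v \<bullet> (\<Xi> *v v) = (\<Sum>i\<in>T. expectation (\<lambda>z. (v \<bullet> f i z)\<^sup>2))" for v
  proof -
    have "v \<bullet> (\<Xi> *v v) = (\<Sum>a\<in>UNIV. \<Sum>c\<in>UNIV. \<Sum>i\<in>T. v $ a * v $ c * expectation (\<lambda>z. f i z $ a * f i z $ c))"
      by (simp add: inner_vec_def matrix_vector_mult_def \<Xi>_def sum_distrib_left sum_distrib_right algebra_simps)
    also have "\<dots> = (\<Sum>i\<in>T. \<Sum>a\<in>UNIV. \<Sum>c\<in>UNIV. v $ a * v $ c * expectation (\<lambda>z. f i z $ a * f i z $ c))"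
      by (simp add: sum.swap[of _ T])
    also have "\<dots> = (\<Sum>i\<in>T. expectation (\<lambda>z. \<Sum>a\<in>UNIV. \<Sum>c\<in>UNIV. v $ a * v $ c * (f i z $ a * f i z $ c)))"
      using ff by (intro sum.cong refl) simp
    also have "\<dots> = (\<Sum>i\<in>T. expectation (\<lambda>z. (v \<bullet> f i z)\<^sup>2))"
      by (simp add: inner_vec_def power2_eq_square sum_product algebra_simps)
    finally show ?thesis .
  qed
  then have "v \<noteq> 0 \<Longrightarrow> 0 < v \<bullet> (\<Xi> *v v)" for v using pos[of v] by simp
  then have "\<forall>v. \<Xi> *v v = 0 \<longrightarrow> v = 0" by (metis inner_zero_right less_irrefl)
  then have "invertible \<Xi>"
    unfolding invertible_left_inverse matrix_left_invertible_ker .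
  define K where "K = \<Gamma> ** matrix_inv \<Xi>"
  have "K ** \<Xi> = \<Gamma>"
    unfolding K_def using matrix_inv_cancel(2)[OF \<open>invertible \<Xi>\<close>] by (simp add: matrix_mul_assoc[symmetric])
  then have normal: "(\<Sum>c\<in>UNIV. K $ b $ c * \<Xi> $ c $ a) = \<Gamma> $ b $ a" for a b
    by (metis (no_types, lifting) matrix_matrix_mult_def sum.cong vec_lambda_beta)
  have "(\<Sum>i\<in>T. expectation (\<lambda>z. f i z \<bullet> (W *v (g i z - K *v f i z)))) = 0" for W :: "real^'m^'n"
  proof -
    have expand: "f i z \<bullet> (W *v (g i z - K *v f i z)) = (\<Sum>a\<in>UNIV. \<Sum>b\<in>UNIV. W $ a $ b *
        (f i z $ a * g i z $ b - (\<Sum>c\<in>UNIV. K $ b $ c * (f i z $ c * f i z $ a))))" for i z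
      by (simp add: inner_vec_def matrix_vector_mult_def sum_distrib_left right_diff_distrib algebra_simps)
    have "(\<Sum>i\<in>T. expectation (\<lambda>z. f i z \<bullet> (W *v (g i z - K *v f i z)))) =
      (\<Sum>i\<in>T. \<Sum>a\<in>UNIV. \<Sum>b\<in>UNIV. W $ a $ b * (expectation (\<lambda>z. f i z $ a * g i z $ b)
        - (\<Sum>c\<in>UNIV. K $ b $ c * expectation (\<lambda>z. f i z $ c * f i z $ a))))"
      unfolding expand using ff fg by (intro sum.cong refl) simp
    also have "\<dots> = (\<Sum>a\<in>UNIV. \<Sum>b\<in>UNIV. W $ a $ b * (\<Gamma> $ b $ a - (\<Sum>c\<in>UNIV. K $ b $ c * \<Xi> $ c $ a)))"
      by (simp add: sum.swap[of _ _ T] \<Gamma>_def \<Xi>_def sum_subtractf sum_distrib_left right_diff_distrib)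
    also have "\<dots> = 0" by (simp add: normal)
    finally show ?thesis .
  qed
  then show thesis using that by blast
qed

text \<open>
Write \<open>g = K f + r\<close> with residual \<open>r\<close>. The cross terms between \<open>f\<close> and \<open>r\<close> cancel in the sum, and the
form of \<open>J r\<close> is nonnegative.
\<close>

lemma least_squares_le:
  fixes f :: "'i \<Rightarrow> 'w \<Rightarrow> real^'n" and g :: "'i \<Rightarrow> 'w \<Rightarrow> real^'m" and K :: "real^'n^'m"
    and H :: "real^'n^'k" and J :: "real^'m^'k"
  assumes f: "\<And>i. i \<in> T \<Longrightarrow> past_L2 t (f i)" and g: "\<And>i. i \<in> T \<Longrightarrow> past_L2 t (g i)"
    and K: "\<And>W. (\<Sum>i\<in>T. expectation (\<lambda>z. f i z \<bullet> (W *v (g i z - K *v f i z)))) = 0"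
    and Q: "pos_semidef Q"
  shows "(\<Sum>i\<in>T. mean_form Q (\<lambda>z. (H + J ** K) *v f i z)) \<le> (\<Sum>i\<in>T. mean_form Q (\<lambda>z. H *v f i z + J *v g i z))"
proof -
  let ?F = "H + J ** K"
  let ?r = "\<lambda>i z. g i z - K *v f i z"
  define W where "W = transpose ?F ** Q ** J"
  have r: "past_L2 t (?r i)" if "i \<in> T" for i
    using past_L2_add[OF g past_L2_matrix[OF f, of _ "- K"]] that by (simp add: matrix_vector_uminus)
  have "mean_form Q (\<lambda>z. H *v f i z + J *v g i z) = mean_form Q (\<lambda>z. ?F *v f i z)
     + 2 * expectation (\<lambda>z. f i z \<bullet> (W *v ?r i z)) + mean_form Q (\<lambda>z. J *v ?r i z)" if i: "i \<in> T" for i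
  proof -
    have "v \<bullet> (transpose ?F *v w) = (?F *v v) \<bullet> w" for v w
      using inner_transpose[of ?F w v] by (simp add: inner_commute)
    then have W: "v \<bullet> (W *v w) = (?F *v v) \<bullet> (Q *v (J *v w))" for v w
      by (simp add: W_def matrix_vector_mul_assoc[symmetric] del: transpose_matrix_vector)
    have "H *v f i z + J *v g i z = ?F *v f i z + J *v ?r i z" for z
      by (simp add: matvec_simps matrix_vector_mult_diff_distrib)
    then have "(H *v f i z + J *v g i z) \<bullet> (Q *v (H *v f i z + J *v g i z)) =
        (?F *v f i z) \<bullet> (Q *v (?F *v f i z)) + 2 * (f i z \<bullet> (W *v ?r i z))
        + (J *v ?r i z) \<bullet> (Q *v (J *v ?r i z))" for z
      using Q by (simp only: W quadratic_form_add pos_semidef_def)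
    then show ?thesis
      unfolding mean_form_def
      using past_L2_form[where Q=Q, OF past_L2_matrix[where R="?F", OF f[OF i]]]
        past_L2_form[where Q=Q, OF past_L2_matrix[where R=J, OF r[OF i]]]
        past_L2_inner(2)[OF f[OF i] past_L2_matrix[where R=W, OF r[OF i]]]
      by (simp del: inner_add_left inner_add_right)
  qed
  then have "(\<Sum>i\<in>T. mean_form Q (\<lambda>z. H *v f i z + J *v g i z)) =
      (\<Sum>i\<in>T. mean_form Q (\<lambda>z. ?F *v f i z)) + 2 * (\<Sum>i\<in>T. expectation (\<lambda>z. f i z \<bullet> (W *v ?r i z)))
      + (\<Sum>i\<in>T. mean_form Q (\<lambda>z. J *v ?r i z))"
    by (simp add: sum.distrib sum_distrib_left)
  moreover have "0 \<le> (\<Sum>i\<in>T. mean_form Q (\<lambda>z. J *v ?r i z))"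
    by (intro sum_nonneg mean_form_nonneg Q)
  ultimately show ?thesis using K by simp
qed

text \<open>
The index \<open>i\<close> runs over the trajectories, one for each unit vector as initial predictor value, so that
the initial terms of a quadratic form \<open>Q\<close> add up to its trace. This makes the Gram matrix of the
predictor invertible and supplies the strict decrease of \<open>\<phi>\<close>.
\<close>

lemma lyap_feasible_if_vanishing:
  fixes y :: "'n \<Rightarrow> nat \<Rightarrow> 'w \<Rightarrow> real^'n" and u :: "'n \<Rightarrow> int \<Rightarrow> 'w \<Rightarrow> real^'m"
    and A :: "real^'n^'n" and L :: "real^'m^'n" and R :: "nat \<Rightarrow> real^'m^'n"
  assumes u: "\<And>i t s. - int D \<le> s \<Longrightarrow> s \<le> int t \<Longrightarrow> past_L2 t (u i s)"
    and y0: "\<And>i z. z \<in> space M \<Longrightarrow> y i 0 z = axis i 1"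
    and step: "\<And>i Q t. mean_form Q (y i (Suc t)) =
      mean_form Q (\<lambda>z. A *v y i t z + L *v u i (int t) z) +
      (\<Sum>\<tau>\<le>D. mean_form Q (\<lambda>z. R \<tau> *v u i (int t - int \<tau>) z))"
    and van_y: "\<And>i. vanishing (y i)"
    and lim_u: "\<And>i. (\<lambda>t. mean_square (u i (int t))) \<longlonglongrightarrow> 0"
  obtains K :: "real^'n^'m" and P where "pos_def P" and "lyap_feasible D (A + L ** K) (\<lambda>\<tau>. R \<tau> ** K) P"
proof -
  have y: "past_L2 t (y i t)" for i t using van_y by (auto simp: vanishing_def)
  \<comment> \<open>what the finite time span misses, relative to the trace: the final predictor value and the last \<open>\<tau>\<close> inputs for each delay\<close>
  define err where "err N = (\<Sum>i\<in>UNIV. mean_square (y i (Suc N)) +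
    (\<Sum>\<tau>\<le>D. \<Sum>j<\<tau>. mean_square (\<lambda>z. R \<tau> *v u i (int N - int j) z)))" for N
  have "err \<longlonglongrightarrow> 0"
    unfolding err_def
  proof (intro tendsto_null_sum tendsto_add_zero)
    show "(\<lambda>N. mean_square (y i (Suc N))) \<longlonglongrightarrow> 0" for i
      using van_y[of i] unfolding vanishing_def by (auto intro: LIMSEQ_Suc)
    show "(\<lambda>N. mean_square (\<lambda>z. R \<tau> *v u i (int N - int j) z)) \<longlonglongrightarrow> 0"
      if "\<tau> \<in> {..D}" "j \<in> {..<\<tau>}" for i \<tau> j
    proof -
      have "vanishing (\<lambda>t. u i (int t - int j))"
        using that by (intro vanishing_inputs_shift u lim_u) auto
      then show ?thesis
        using vanishing_matrix[of "\<lambda>t. u i (int t - int j)" "R \<tau>"] by (simp add: vanishing_def)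
    qed
  qed
  then have "eventually (\<lambda>N. err N < 1 / 2) sequentially" by (rule order_tendstoD) simp
  then obtain N where N: "err N < 1 / 2" by (auto simp: eventually_sequentially)
  define T where "T = (UNIV :: 'n set) \<times> {..<Suc N}"
  define f where "f p = y (fst p) (snd p)" for p
  define g where "g p = u (fst p) (int (snd p))" for p
  have f: "past_L2 N (f p)" and g: "past_L2 N (g p)" if "p \<in> T" for p
    using that unfolding f_def g_def T_def by (auto intro: past_L2_mono[OF y] u)
  have T_sum: "(\<Sum>p\<in>T. h (fst p) (snd p)) = (\<Sum>i\<in>UNIV. \<Sum>t<Suc N. h i t)" for h :: "'n \<Rightarrow> nat \<Rightarrow> real"
    unfolding T_def by (simp add: sum.cartesian_product case_prod_beta del: sum.lessThan_Suc)
  have initial: "(\<Sum>i\<in>UNIV. mean_form Q (y i 0)) = trace Q" for Q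
    unfolding trace_quadratic by (intro sum.cong refl mean_form_const y0)
  define \<phi> where "\<phi> Q = (\<Sum>p\<in>T. mean_form Q (f p))" for Q
  have \<phi>_eq: "\<phi> Q = (\<Sum>i\<in>UNIV. \<Sum>t<Suc N. mean_form Q (y i t))" for Q
    unfolding \<phi>_def f_def by (rule T_sum)
  have trace_le: "trace Q \<le> \<phi> Q" if "pos_semidef Q" for Q
    unfolding initial[symmetric] \<phi>_eq
    by (intro sum_mono member_le_sum[of 0]) (auto intro: mean_form_nonneg that)
  have pos: "0 < (\<Sum>p\<in>T. expectation (\<lambda>z. (v \<bullet> f p z)\<^sup>2))" if v: "v \<noteq> 0" for v
  proof -
    have "expectation (\<lambda>z. (v \<bullet> f (i, 0) z)\<^sup>2) = (v $ i)\<^sup>2" for i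
    proof -
      have "expectation (\<lambda>z. (v \<bullet> f (i, 0) z)\<^sup>2) = expectation (\<lambda>z. (v $ i)\<^sup>2)"
        using y0 by (intro Bochner_Integration.integral_cong) (auto simp: f_def inner_axis)
      then show ?thesis by (simp add: prob_space)
    qed
    moreover obtain i where "v $ i \<noteq> 0" using v by (auto simp: vec_eq_iff)
    ultimately show ?thesis
      by (intro sum_pos2[of _ "(i, 0)"]) (auto simp: T_def)
  qed
  obtain K where K: "\<And>W. (\<Sum>p\<in>T. expectation (\<lambda>z. f p z \<bullet> (W *v (g p z - K *v f p z)))) = 0"
    by (rule least_squares_gain[OF f g pos]; (assumption | rule that))
  let ?F = "A + L ** K" and ?G = "\<lambda>\<tau>. R \<tau> ** K"
  have drop: "\<phi> (lyap D ?F ?G Q) \<le> \<phi> Q - trace Q / 2" if Q: "pos_semidef Q" for Q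
  proof -
    let ?c = "\<lambda>i \<tau> s. mean_form Q (\<lambda>z. R \<tau> *v u i s z)"
    have tr: "0 \<le> trace Q"
      unfolding initial[symmetric] by (intro sum_nonneg mean_form_nonneg Q)
    have "\<phi> (lyap D ?F ?G Q) = (\<Sum>p\<in>T. mean_form Q (\<lambda>z. ?F *v f p z))
        + (\<Sum>\<tau>\<le>D. \<Sum>p\<in>T. mean_form Q (\<lambda>z. ?G \<tau> *v f p z))"
      unfolding \<phi>_def sum.swap[of _ T] sum.distrib[symmetric]
      by (intro sum.cong refl mean_form_lyap[OF f])
    also have "\<dots> \<le> (\<Sum>p\<in>T. mean_form Q (\<lambda>z. A *v f p z + L *v g p z))
        + (\<Sum>\<tau>\<le>D. \<Sum>p\<in>T. mean_form Q (\<lambda>z. R \<tau> *v g p z))"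
    proof (rule add_mono)
      show "(\<Sum>p\<in>T. mean_form Q (\<lambda>z. ?F *v f p z)) \<le> (\<Sum>p\<in>T. mean_form Q (\<lambda>z. A *v f p z + L *v g p z))"
        by (rule least_squares_le[OF f g K Q])
      show "(\<Sum>\<tau>\<le>D. \<Sum>p\<in>T. mean_form Q (\<lambda>z. ?G \<tau> *v f p z))
          \<le> (\<Sum>\<tau>\<le>D. \<Sum>p\<in>T. mean_form Q (\<lambda>z. R \<tau> *v g p z))"
        by (rule sum_mono) (use least_squares_le[OF f g K Q, of 0] in simp)
    qed
    also have "(\<Sum>p\<in>T. mean_form Q (\<lambda>z. A *v f p z + L *v g p z)) =
        (\<Sum>i\<in>UNIV. \<Sum>t<Suc N. mean_form Q (\<lambda>z. A *v y i t z + L *v u i (int t) z))"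
      unfolding f_def g_def by (rule T_sum)
    also have "(\<Sum>\<tau>\<le>D. \<Sum>p\<in>T. mean_form Q (\<lambda>z. R \<tau> *v g p z)) =
        (\<Sum>\<tau>\<le>D. \<Sum>i\<in>UNIV. \<Sum>t<Suc N. ?c i \<tau> (int t))"
      unfolding g_def by (intro sum.cong refl T_sum)
    also have "\<dots> = (\<Sum>i\<in>UNIV. \<Sum>\<tau>\<le>D. \<Sum>t<Suc N. ?c i \<tau> (int t))"
      by (rule sum.swap)
    also have "\<dots> \<le> (\<Sum>i\<in>UNIV. \<Sum>\<tau>\<le>D. (\<Sum>t<Suc N. ?c i \<tau> (int t - int \<tau>)) + (\<Sum>j<\<tau>. ?c i \<tau> (int N - int j)))"
    proof (intro sum_mono)
      fix i \<tau>
      have "0 \<le> (\<Sum>j<\<tau>. ?c i \<tau> (- 1 - int j))" by (intro sum_nonneg mean_form_nonneg Q)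
      then show "(\<Sum>t<Suc N. ?c i \<tau> (int t)) \<le>
          (\<Sum>t<Suc N. ?c i \<tau> (int t - int \<tau>)) + (\<Sum>j<\<tau>. ?c i \<tau> (int N - int j))"
        using sum_shifted[of "?c i \<tau>" \<tau> "Suc N"] by simp
    qed
    \<comment> \<open>with the delayed inputs restored, the right-hand side is the second moment one step later\<close>
    also have "(\<Sum>i\<in>UNIV. \<Sum>t<Suc N. mean_form Q (\<lambda>z. A *v y i t z + L *v u i (int t) z)) + \<dots> =
        (\<Sum>i\<in>UNIV. (\<Sum>t<Suc N. mean_form Q (y i (Suc t))) + (\<Sum>\<tau>\<le>D. \<Sum>j<\<tau>. ?c i \<tau> (int N - int j)))"
      unfolding step sum.distrib sum.swap[of _ "{..D}" "{..<Suc N}"] by simp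
    also have "\<dots> = (\<Sum>i\<in>UNIV. (\<Sum>t<Suc N. mean_form Q (y i t)) - mean_form Q (y i 0) +
        (mean_form Q (y i (Suc N)) + (\<Sum>\<tau>\<le>D. \<Sum>j<\<tau>. ?c i \<tau> (int N - int j))))"
    proof (intro sum.cong refl)
      fix i
      show "(\<Sum>t<Suc N. mean_form Q (y i (Suc t))) + (\<Sum>\<tau>\<le>D. \<Sum>j<\<tau>. ?c i \<tau> (int N - int j)) =
        (\<Sum>t<Suc N. mean_form Q (y i t)) - mean_form Q (y i 0) +
        (mean_form Q (y i (Suc N)) + (\<Sum>\<tau>\<le>D. \<Sum>j<\<tau>. ?c i \<tau> (int N - int j)))"
        using sum.lessThan_Suc_shift[of "\<lambda>t. mean_form Q (y i t)" "Suc N"]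
          sum.lessThan_Suc[of "\<lambda>t. mean_form Q (y i t)" "Suc N"] by linarith
    qed
    also have "\<dots> = \<phi> Q - trace Q + (\<Sum>i\<in>UNIV. mean_form Q (y i (Suc N)) + (\<Sum>\<tau>\<le>D. \<Sum>j<\<tau>. ?c i \<tau> (int N - int j)))"
      unfolding \<phi>_eq initial[symmetric] by (simp only: sum.distrib sum_subtractf)
    also have "(\<Sum>i\<in>UNIV. mean_form Q (y i (Suc N)) + (\<Sum>\<tau>\<le>D. \<Sum>j<\<tau>. ?c i \<tau> (int N - int j))) \<le> trace Q * err N"
      unfolding err_def sum_distrib_left distrib_left
      by (intro sum_mono add_mono mean_form_le_trace[OF Q y]
          mean_form_le_trace[OF Q past_L2_matrix[OF u[of _ N]]]) auto
    also have "trace Q * err N \<le> trace Q / 2"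
      using mult_left_mono[OF less_imp_le[OF N] tr] by simp
    finally show ?thesis by simp
  qed
  \<comment> \<open>\<open>\<phi>\<close> is comparable to the trace, so an absolute decrease by half the trace is a decrease by a fixed factor\<close>
  define c where "c = (\<Sum>p\<in>T. mean_square (f p))"
  have "1 \<le> real CARD('n)" by simp
  also have "\<dots> \<le> c"
    using trace_le[OF pos_semidef_mat1] by (simp add: c_def \<phi>_def trace_I)
  finally have c: "1 \<le> c" .
  have upper: "\<phi> Q \<le> c * trace Q" if "pos_semidef Q" for Q
    unfolding \<phi>_def c_def sum_distrib_right
    using mean_form_le_trace[OF that f] by (intro sum_mono) (simp add: mult.commute)
  show thesis
  proof (rule lyap_feasible_if_contraction[of \<phi> D ?F ?G "1 - 1 / (2 * c)"])
    show "\<phi> (lyap D ?F ?G Q) \<le> (1 - 1 / (2 * c)) * \<phi> Q" if "pos_semidef Q" for Q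
    proof -
      have "\<phi> Q / (2 * c) \<le> trace Q / 2" using upper[OF that] c by (simp add: field_simps)
      then show ?thesis using drop[OF that] by (simp add: algebra_simps)
    qed
  qed (use trace_le c that in \<open>auto simp: field_simps\<close>)
qed

text \<open>
Starting at \<open>A\<^sup>-\<^sup>D e\<^sub>i\<close> with zero initial inputs gives the trajectory whose predictor starts at \<open>e\<^sub>i\<close>.
\<close>

theorem lyap_feasible_if_stabilizable:
  fixes A :: "real^'n^'n" and B C :: "nat \<Rightarrow> real^'m^'n"
  assumes A: "invertible A" and stab: "ms_stabilizable M D A B C \<omega>"
  obtains K :: "real^'n^'m" and P where "pos_def P"
    and "lyap_feasible D (A + Lmat D A B ** K) (\<lambda>\<tau>. \<sigma> \<tau> *\<^sub>R (matpow A D ** C \<tau> ** K)) P"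
proof -
  let ?x0 = "\<lambda>i :: 'n. matrix_inv (matpow A D) *v axis i 1"
  obtain K0 K' where stab': "\<forall>x0 u0. \<exists>u \<in> U_ad M D A B C \<omega> x0 u0.
        let x = state D A B C \<omega> x0 u in feedback_law M D K0 K' x u \<and>
          (\<forall>t. integrable M (\<lambda>z. x t z \<bullet> x t z)) \<and> (\<lambda>t. expectation (\<lambda>z. x t z \<bullet> x t z)) \<longlonglongrightarrow> 0"
    using stab unfolding ms_stabilizable_def by (elim exE) (rule that)
  define good where "good i u \<longleftrightarrow> u \<in> U_ad M D A B C \<omega> (?x0 i) (\<lambda>_. 0) \<and>
        feedback_law M D K0 K' (state D A B C \<omega> (?x0 i) u) u \<and>
        (\<lambda>t. expectation (\<lambda>z. state D A B C \<omega> (?x0 i) u t z \<bullet> state D A B C \<omega> (?x0 i) u t z)) \<longlonglongrightarrow> 0"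
    for i u
  have "\<exists>u. good i u" for i
    using stab'[rule_format, of "?x0 i" "\<lambda>_. 0"] unfolding good_def Let_def by blast
  then obtain u where "\<And>i. good i (u i)" by metis
  then have ad: "\<And>i. u i \<in> U_ad M D A B C \<omega> (?x0 i) (\<lambda>_. 0)"
    and fb: "\<And>i. feedback_law M D K0 K' (state D A B C \<omega> (?x0 i) (u i)) (u i)"
    and lim: "\<And>i. (\<lambda>t. expectation (\<lambda>z. state D A B C \<omega> (?x0 i) (u i) t z \<bullet> state D A B C \<omega> (?x0 i) (u i) t z)) \<longlonglongrightarrow> 0"
    unfolding good_def by blast+
  define x where "x i = state D A B C \<omega> (?x0 i) (u i)" for i
  define y where "y i = predictor D A B (x i) (u i)" for i
  have init: "u i s z = 0" if "- int D \<le> s" "s < 0" "z \<in> space M" for i s z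
    using ad[of i] that unfolding U_ad_def by auto
  have x: "past_L2 t (x i t)" for i t
    unfolding x_def by (rule closed_loop_past_L2(1)[OF fb]) (rule init)
  have u: "past_L2 t (u i s)" if "- int D \<le> s" "s \<le> int t" for i s t
    by (rule closed_loop_past_L2(2)[OF fb _ that]) (rule init)
  have lim_u: "(\<lambda>t. mean_square (u i (int t))) \<longlonglongrightarrow> 0" for i
    using ad[of i] unfolding U_ad_def mean_square_eq by (auto intro: summable_LIMSEQ_zero)
  have "vanishing (x i)" for i
    using x lim[of i] by (simp add: vanishing_def mean_square_eq x_def)
  then have van_y: "vanishing (y i)" for i
    unfolding y_def predictor_def[abs_def]
    by (intro vanishing_add vanishing_matrix vanishing_sum vanishing_inputs_shift u lim_u) auto
  have y0: "y i 0 z = axis i 1" if "z \<in> space M" for i z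
    using that
    by (simp add: y_def predictor_def x_def init matrix_vector_mul_assoc
        matrix_inv_cancel[OF invertible_matpow[OF A]])
  have step: "mean_form Q (y i (Suc t)) =
      mean_form Q (\<lambda>z. A *v y i t z + Lmat D A B *v u i (int t) z) +
      (\<Sum>\<tau>\<le>D. mean_form Q (\<lambda>z. (\<sigma> \<tau> *\<^sub>R (matpow A D ** C \<tau>)) *v u i (int t - int \<tau>) z))" for i Q t
    by (rule predictor_moment_step[OF x_def y_def x u])
  show thesis
  proof (rule lyap_feasible_if_vanishing[OF u y0 step van_y lim_u])
    fix K P
    assume "pos_def P"
      and "lyap_feasible D (A + Lmat D A B ** K) (\<lambda>\<tau>. (\<sigma> \<tau> *\<^sub>R (matpow A D ** C \<tau>)) ** K) P"
    then show thesis
      using that by (simp add: lyap_feasible_def lyap_quadratic matvec_simps)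
  qed
qed

end

theorem corollary1:
  fixes M :: "'w measure"
    and D :: nat
    and A :: "real^'n^'n"
    and B C :: "nat \<Rightarrow> real^'m^'n"
    and \<sigma> :: "nat \<Rightarrow> real"
    and \<omega> :: "nat \<Rightarrow> nat \<Rightarrow> 'w \<Rightarrow> real"
  assumes "noise_model M D \<sigma> \<omega>"
    and "invertible A"
  shows "ms_stabilizable M D A B C \<omega> \<longleftrightarrow>
    (\<exists>(Y :: real^'n^'m) (S :: real^'n^'n).
       neg_def S \<and>
       block_neg_def (D + 3) (lmi_matrix D A B C \<sigma> Y S) \<and>
       (\<exists>(K :: real^'n^'m) (P :: real^'n^'n).
          pos_def P \<and> Y = - (K ** matrix_inv P) \<and> S = - matrix_inv P))"
proof -
  interpret delayed_noise M D \<sigma> \<omega> using assms(1) by unfold_locales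
  show ?thesis
  proof
    assume "ms_stabilizable M D A B C \<omega>"
    then obtain K P where P: "pos_def P"
      and feas: "lyap_feasible D (A + Lmat D A B ** K) (\<lambda>\<tau>. \<sigma> \<tau> *\<^sub>R (matpow A D ** C \<tau> ** K)) P"
      using lyap_feasible_if_stabilizable[OF assms(2)] by blast
    have "neg_def (- matrix_inv P)"
      using pos_def_matrix_inv[OF P]
      by (auto simp: neg_def_def pos_def_def matrix_vector_uminus transpose_def vec_eq_iff)
    then show "\<exists>(Y :: real^'n^'m) (S :: real^'n^'n). neg_def S \<and>
       block_neg_def (D + 3) (lmi_matrix D A B C \<sigma> Y S) \<and>
       (\<exists>(K :: real^'n^'m) (P :: real^'n^'n).
          pos_def P \<and> Y = - (K ** matrix_inv P) \<and> S = - matrix_inv P)"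
      using lmi_iff_lyap_feasible[OF P refl refl] feas P by blast
  next
    assume "\<exists>(Y :: real^'n^'m) (S :: real^'n^'n). neg_def S \<and>
       block_neg_def (D + 3) (lmi_matrix D A B C \<sigma> Y S) \<and>
       (\<exists>(K :: real^'n^'m) (P :: real^'n^'n).
          pos_def P \<and> Y = - (K ** matrix_inv P) \<and> S = - matrix_inv P)"
    then obtain K P where P: "pos_def P"
      and "lyap_feasible D (A + Lmat D A B ** K) (\<lambda>\<tau>. \<sigma> \<tau> *\<^sub>R (matpow A D ** C \<tau> ** K)) P"
      using lmi_iff_lyap_feasible by blast
    then show "ms_stabilizable M D A B C \<omega>"
      using stabilizable_if_lyap_feasible[OF assms(2)] by blast
  qed
qed

end
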